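(* Let $\bar\pi=\{\bar\delta_0,\dots,\bar\delta_N\}$ be a periodic triggering policy with period $k_p$, and let $\pi^+$ be the triggering policy $\delta_k^+=\mathbf{1}_{\{\mathrm{VoI}^{\bar\pi}_k\ge0\}}$, where $\mathrm{VoI}^{\bar\pi}_k$ is the value of information with $\varrho_k$ replaced by $\varrho^{\bar\pi}_k$. Then, in both the perfect and the imperfect information settings, $\Psi(\pi^+,\mu^* )\le\Psi(\bar\pi,\mu^* )$, where $\mu^*$ is the control policy $u_k=-L_k\hat x_k$.
   Context: Setting (common): $x_{k+1}=A_kx_k+B_ku_k+w_k$, $k=0,\dots,N$, $x_0\sim\mathcal N(m_0,M_0)$, $w_k$ i.i.d. $\mathcal N(0,W_k)$, $W_k\succ0$, $(A_k,B_k)$ controllable; an event trigger chooses $\delta_k\in\{0,1\}$ and the observation at time $k$ is transmitted to the controller with one-step delay iff $\delta_k=1$; information associated with non-transmitted observations is discarded at the controller. Cost $\Psi(\pi,\mu)=\mathbb{E}\big[x_{N+1}^TQ_{N+1}x_{N+1}+\sum_{k=0}^Nx_k^TQ_kx_k+u_k^TR_ku_k+\theta_k\delta_k\big]$, $Q_k\succeq0$, $R_k\succ0$, $\theta_k\ge0$. Riccati: $S_{N+1}=Q_{N+1}$, $S_k=Q_k+A_k^TS_{k+1}A_k-\Gamma_k$, $\Gamma_k=A_k^TS_{k+1}B_k(B_k^TS_{k+1}B_k+R_k)^{-1}B_k^TS_{k+1}A_k$, $\Gamma_{N+1}=0$, $L_k=(B_k^TS_{k+1}B_k+R_k)^{-1}B_k^TS_{k+1}A_k$.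 Perfect information: observation $x_k$; $\mathcal{I}^e_k=\{x_t:t\le k\}$, $\mathcal{I}^c_k=\{x_t:t<k,\delta_t=1\}$; $\hat x_0=m_0$, $\hat x_k=A_{k-1}\hat x_{k-1}+B_{k-1}u_{k-1}+\delta_{k-1}A_{k-1}(x_{k-1}-\hat x_{k-1})$; $e_k=x_k-\hat x_k$; value of information $\mathrm{VoI}_k=e_k^TA_k^T\Gamma_{k+1}A_ke_k-\theta_k+\varrho_k$. Imperfect information: observation $y_k=C_kx_k+v_k$, $v_k$ i.i.d. $\mathcal N(0,V_k)$, $V_k\succ0$, $(A_k,C_k)$ observable; $\mathcal{I}^e_k=\{y_t:t\le k\}$, $\mathcal{I}^c_k=\{y_t:t<k,\delta_t=1\}$; $\check x_k=\mathbb{E}[x_k\mid\mathcal{I}^e_k]$ (Kalman filter); $\hat x_0=m_0$, $P_0=M_0$, $\hat x_k=A_{k-1}\hat x_{k-1}+B_{k-1}u_{k-1}+\delta_{k-1}K_{k-1}(y_{k-1}-C_{k-1}\hat x_{k-1})$, $P_k=A_{k-1}P_{k-1}A_{k-1}^T+W_{k-1}-\delta_{k-1}K_{k-1}C_{k-1}P_{k-1}A_{k-1}^T$, $K_k=A_kP_kC_k^T(C_kP_kC_k^T+V_k)^{-1}$; $e_k=x_k-\hat x_k$, $\nu_k=y_k-C_k\hat x_k$, $\varepsilon_k=\check x_k-\hat x_k$; value of information $\mathrm{VoI}_k=\nu_k^TK_k^T\Gamma_{k+1}(2A_k\varepsilon_k-K_k\nu_k)-\theta_k+\varrho_k$. Approximation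 (Algorithm 1): for the periodic policy $\bar\pi$, $\varrho^{\bar\pi}_k=\mathbb{E}[V^{\bar\pi}_{k+1}\mid\mathcal{I}^e_k,\delta_k=0]-\mathbb{E}[V^{\bar\pi}_{k+1}\mid\mathcal{I}^e_k,\delta_k=1]$ where $\mathbb{E}[V^{\bar\pi}_{k+1}\mid\mathcal{I}^e_k,\delta_k]=\mathbb{E}\big[\sum_{t=k+1}^N\theta_t\delta_t+e_{t+1}^T\Gamma_{t+1}e_{t+1}\mid\mathcal{I}^e_k,\delta_k\big]$ computed with $\delta_t=\bar\delta_t$ for all $t\ge k+1$ and control $u_t=-L_t\hat x_t$. *)

theory Defs
  imports "HOL-Probability.Probability"
begin

section \<open>Matrix notions\<close>

text \<open>Symmetric positive semidefinite / positive definite matrices.\<close>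
definition psd_mat :: "real^'n^'n \<Rightarrow> bool" where
  "psd_mat S \<longleftrightarrow> transpose S = S \<and> (\<forall>x. 0 \<le> x \<bullet> (S *v x))"

definition pd_mat :: "real^'n^'n \<Rightarrow> bool" where
  "pd_mat S \<longleftrightarrow> transpose S = S \<and> (\<forall>x. x \<noteq> 0 \<longrightarrow> 0 < x \<bullet> (S *v x))"

text \<open>(A,B) controllable: the controllability matrix [B, AB, ..., A^(n-1) B] has full rank n,
  i.e. its range is the whole state space.\<close>
definition controllable :: "real^'n^'n \<Rightarrow> real^'m^'n \<Rightarrow> bool" where
  "controllable A B \<longleftrightarrow>
     (\<forall>z. \<exists>u :: nat \<Rightarrow> real^'m. z = (\<Sum>i<CARD('n). (((*v) A) ^^ i) (B *v u i)))"

text \<open>(A,C) observable: the observability matrix [C; CA; ...; C A^(n-1)] has trivial kernel.\<close>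
definition observable :: "real^'n^'n \<Rightarrow> real^'n^'p \<Rightarrow> bool" where
  "observable A C \<longleftrightarrow>
     (\<forall>x. (\<forall>i<CARD('n). C *v ((((*v) A) ^^ i) x) = 0) \<longrightarrow> x = 0)"

section \<open>Gaussian random vectors\<close>

text \<open>X ~ N(m, Sig) (possibly degenerate): every linear functional a.X is normal with mean a.m and
  variance a'Sig a (a.s. constant if the variance is 0).\<close>
definition gaussian_rv :: "'w measure \<Rightarrow> ('w \<Rightarrow> real^'n) \<Rightarrow> real^'n \<Rightarrow> real^'n^'n \<Rightarrow> bool" where
  "gaussian_rv M X m Sig \<longleftrightarrow> X \<in> borel_measurable M \<and>
     (\<forall>a. if a \<bullet> (Sig *v a) = 0 then (AE \<omega> in M. a \<bullet> X \<omega> = a \<bullet> m)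
          else distributed M lborel (\<lambda>\<omega>. a \<bullet> X \<omega>)
                 (\<lambda>r. ennreal (normal_density (a \<bullet> m) (sqrt (a \<bullet> (Sig *v a))) r)))"

text \<open>Index type for the primitive random variables x0, w_k, v_k.\<close>
datatype noise_idx = X0 | Wn nat | Vn nat

section \<open>Riccati recursion\<close>

definition riccati_step ::
  "(nat \<Rightarrow> real^'n^'n) \<Rightarrow> (nat \<Rightarrow> real^'m^'n) \<Rightarrow> (nat \<Rightarrow> real^'n^'n) \<Rightarrow> (nat \<Rightarrow> real^'m^'m)
   \<Rightarrow> nat \<Rightarrow> real^'n^'n \<Rightarrow> real^'n^'n" where
  "riccati_step A B Q R k S1 =
     Q k + transpose (A k) ** S1 ** A k
     - transpose (A k) ** S1 ** B k ** matrix_inv (transpose (B k) ** S1 ** B k + R k)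
         ** transpose (B k) ** S1 ** A k"

text \<open>ric_back j = S_(N+1-j).\<close>
primrec ric_back ::
  "(nat \<Rightarrow> real^'n^'n) \<Rightarrow> (nat \<Rightarrow> real^'m^'n) \<Rightarrow> (nat \<Rightarrow> real^'n^'n) \<Rightarrow> (nat \<Rightarrow> real^'m^'m)
   \<Rightarrow> nat \<Rightarrow> nat \<Rightarrow> real^'n^'n" where
  "ric_back A B Q R N 0 = Q (Suc N)"
| "ric_back A B Q R N (Suc j) = riccati_step A B Q R (N - j) (ric_back A B Q R N j)"

text \<open>S_k for k = 0..N+1, with S_(N+1) = Q_(N+1).\<close>
definition ricS ::
  "(nat \<Rightarrow> real^'n^'n) \<Rightarrow> (nat \<Rightarrow> real^'m^'n) \<Rightarrow> (nat \<Rightarrow> real^'n^'n) \<Rightarrow> (nat \<Rightarrow> real^'m^'m)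
   \<Rightarrow> nat \<Rightarrow> nat \<Rightarrow> real^'n^'n" where
  "ricS A B Q R N k = ric_back A B Q R N (Suc N - k)"

text \<open>Gamma_k (k = 0..N), Gamma_(N+1) = 0.\<close>
definition ricGamma ::
  "(nat \<Rightarrow> real^'n^'n) \<Rightarrow> (nat \<Rightarrow> real^'m^'n) \<Rightarrow> (nat \<Rightarrow> real^'n^'n) \<Rightarrow> (nat \<Rightarrow> real^'m^'m)
   \<Rightarrow> nat \<Rightarrow> nat \<Rightarrow> real^'n^'n" where
  "ricGamma A B Q R N k =
     (if k = Suc N then 0 else
      (let S1 = ricS A B Q R N (Suc k) in
       transpose (A k) ** S1 ** B k ** matrix_inv (transpose (B k) ** S1 ** B k + R k)
         ** transpose (B k) ** S1 ** A k))"

text \<open>Feedback gain L_k.\<close>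
definition ricL ::
  "(nat \<Rightarrow> real^'n^'n) \<Rightarrow> (nat \<Rightarrow> real^'m^'n) \<Rightarrow> (nat \<Rightarrow> real^'n^'n) \<Rightarrow> (nat \<Rightarrow> real^'m^'m)
   \<Rightarrow> nat \<Rightarrow> nat \<Rightarrow> real^'n^'m" where
  "ricL A B Q R N k =
     (let S1 = ricS A B Q R N (Suc k) in
      matrix_inv (transpose (B k) ** S1 ** B k + R k) ** transpose (B k) ** S1 ** A k)"

section \<open>Trigger sequences\<close>

text \<open>A triggering decision sequence is d :: nat => 'w => bool (delta_k(omega) = 1 iff d k omega).
  The periodic policy is a deterministic sequence dbar with period kp.\<close>
definition periodic_policy :: "nat \<Rightarrow> (nat \<Rightarrow> bool) \<Rightarrow> bool" where
  "periodic_policy kp dbar \<longleftrightarrow> 0 < kp \<and> (\<forall>k. dbar (k + kp) = dbar k)"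

text \<open>Use d before time k, the value b at time k, and the periodic policy dbar after time k.\<close>
definition switch_at :: "(nat \<Rightarrow> 'w \<Rightarrow> bool) \<Rightarrow> nat \<Rightarrow> bool \<Rightarrow> (nat \<Rightarrow> bool) \<Rightarrow> nat \<Rightarrow> 'w \<Rightarrow> bool" where
  "switch_at d k b dbar = (\<lambda>t \<omega>. if t < k then d t \<omega> else if t = k then b else dbar t)"

definition ind :: "bool \<Rightarrow> real" where
  "ind b = (if b then 1 else 0)"

section \<open>Perfect information\<close>

text \<open>Closed loop (x_k, xhat_k) under trigger d and control u_k = - L_k xhat_k.\<close>
primrec pcl ::
  "(nat \<Rightarrow> real^'n^'n) \<Rightarrow> (nat \<Rightarrow> real^'m^'n) \<Rightarrow> (nat \<Rightarrow> real^'n^'m) \<Rightarrow> real^'n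
   \<Rightarrow> ('w \<Rightarrow> real^'n) \<Rightarrow> (nat \<Rightarrow> 'w \<Rightarrow> real^'n) \<Rightarrow> (nat \<Rightarrow> 'w \<Rightarrow> bool)
   \<Rightarrow> nat \<Rightarrow> 'w \<Rightarrow> (real^'n) \<times> (real^'n)" where
  "pcl A B L m0 x0 w d 0 \<omega> = (x0 \<omega>, m0)"
| "pcl A B L m0 x0 w d (Suc k) \<omega> =
     (let x = fst (pcl A B L m0 x0 w d k \<omega>); xh = snd (pcl A B L m0 x0 w d k \<omega>);
          u = - (L k *v xh) in
      (A k *v x + B k *v u + w k \<omega>,
       A k *v xh + B k *v u + (if d k \<omega> then A k *v (x - xh) else 0)))"

text \<open>Realized cost of one sample path under trigger d and control mu*.\<close>
definition pcost ::
  "(nat \<Rightarrow> real^'n^'n) \<Rightarrow> (nat \<Rightarrow> real^'m^'n) \<Rightarrow> (nat \<Rightarrow> real^'n^'n) \<Rightarrow> (nat \<Rightarrow> real^'m^'m)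
   \<Rightarrow> (nat \<Rightarrow> real) \<Rightarrow> nat \<Rightarrow> real^'n \<Rightarrow> ('w \<Rightarrow> real^'n) \<Rightarrow> (nat \<Rightarrow> 'w \<Rightarrow> real^'n)
   \<Rightarrow> (nat \<Rightarrow> 'w \<Rightarrow> bool) \<Rightarrow> 'w \<Rightarrow> real" where
  "pcost A B Q R th N m0 x0 w d \<omega> =
     (let L = ricL A B Q R N;
          x = (\<lambda>k. fst (pcl A B L m0 x0 w d k \<omega>));
          u = (\<lambda>k. - (L k *v snd (pcl A B L m0 x0 w d k \<omega>))) in
      x (Suc N) \<bullet> (Q (Suc N) *v x (Suc N))
      + (\<Sum>k\<le>N. x k \<bullet> (Q k *v x k) + u k \<bullet> (R k *v u k) + th k * ind (d k \<omega>)))"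

text \<open>Psi(pi, mu*) (as a nonnegative extended real expectation).\<close>
definition pPsi ::
  "'w measure \<Rightarrow> (nat \<Rightarrow> real^'n^'n) \<Rightarrow> (nat \<Rightarrow> real^'m^'n) \<Rightarrow> (nat \<Rightarrow> real^'n^'n) \<Rightarrow> (nat \<Rightarrow> real^'m^'m)
   \<Rightarrow> (nat \<Rightarrow> real) \<Rightarrow> nat \<Rightarrow> real^'n \<Rightarrow> ('w \<Rightarrow> real^'n) \<Rightarrow> (nat \<Rightarrow> 'w \<Rightarrow> real^'n)
   \<Rightarrow> (nat \<Rightarrow> 'w \<Rightarrow> bool) \<Rightarrow> ennreal" where
  "pPsi M A B Q R th N m0 x0 w d = (\<integral>\<^sup>+ \<omega>. ennreal (pcost A B Q R th N m0 x0 w d \<omega>) \<partial>M)"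

text \<open>sigma-algebra of the event-trigger information I^e_k = {x_t : t <= k} under trigger d.\<close>
definition pinfo ::
  "'w measure \<Rightarrow> (nat \<Rightarrow> real^'n^'n) \<Rightarrow> (nat \<Rightarrow> real^'m^'n) \<Rightarrow> (nat \<Rightarrow> real^'n^'m) \<Rightarrow> real^'n
   \<Rightarrow> ('w \<Rightarrow> real^'n) \<Rightarrow> (nat \<Rightarrow> 'w \<Rightarrow> real^'n) \<Rightarrow> (nat \<Rightarrow> 'w \<Rightarrow> bool) \<Rightarrow> nat \<Rightarrow> 'w measure" where
  "pinfo M A B L m0 x0 w d k =
     sigma (space M)
       (\<Union>t\<in>{..k}. {(\<lambda>\<omega>. fst (pcl A B L m0 x0 w d t \<omega>)) -` S \<inter> space M | S. S \<in> sets borel})"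

text \<open>Cost-to-go sum_(t=k+1)^N theta_t dbar_t + e_(t+1)' Gamma_(t+1) e_(t+1) when delta_k = b and
  delta_t = dbar_t for t >= k+1 (history before k given by d).\<close>
definition pJ ::
  "(nat \<Rightarrow> real^'n^'n) \<Rightarrow> (nat \<Rightarrow> real^'m^'n) \<Rightarrow> (nat \<Rightarrow> real^'n^'n) \<Rightarrow> (nat \<Rightarrow> real^'m^'m)
   \<Rightarrow> (nat \<Rightarrow> real) \<Rightarrow> nat \<Rightarrow> real^'n \<Rightarrow> ('w \<Rightarrow> real^'n) \<Rightarrow> (nat \<Rightarrow> 'w \<Rightarrow> real^'n)
   \<Rightarrow> (nat \<Rightarrow> bool) \<Rightarrow> (nat \<Rightarrow> 'w \<Rightarrow> bool) \<Rightarrow> nat \<Rightarrow> bool \<Rightarrow> 'w \<Rightarrow> real" where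
  "pJ A B Q R th N m0 x0 w dbar d k b \<omega> =
     (let G = ricGamma A B Q R N;
          e = (\<lambda>t. fst (pcl A B (ricL A B Q R N) m0 x0 w (switch_at d k b dbar) t \<omega>)
                  - snd (pcl A B (ricL A B Q R N) m0 x0 w (switch_at d k b dbar) t \<omega>)) in
      (\<Sum>t\<in>{Suc k..N}. th t * ind (dbar t) + e (Suc t) \<bullet> (G (Suc t) *v e (Suc t))))"

text \<open>rho^pibar_k = E[V_(k+1) | I^e_k, delta_k = 0] - E[V_(k+1) | I^e_k, delta_k = 1].\<close>
definition prho ::
  "'w measure \<Rightarrow> (nat \<Rightarrow> real^'n^'n) \<Rightarrow> (nat \<Rightarrow> real^'m^'n) \<Rightarrow> (nat \<Rightarrow> real^'n^'n) \<Rightarrow> (nat \<Rightarrow> real^'m^'m)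
   \<Rightarrow> (nat \<Rightarrow> real) \<Rightarrow> nat \<Rightarrow> real^'n \<Rightarrow> ('w \<Rightarrow> real^'n) \<Rightarrow> (nat \<Rightarrow> 'w \<Rightarrow> real^'n)
   \<Rightarrow> (nat \<Rightarrow> bool) \<Rightarrow> (nat \<Rightarrow> 'w \<Rightarrow> bool) \<Rightarrow> nat \<Rightarrow> 'w \<Rightarrow> real" where
  "prho M A B Q R th N m0 x0 w dbar d k \<omega> =
     (let F = pinfo M A B (ricL A B Q R N) m0 x0 w d k in
      real_cond_exp M F (pJ A B Q R th N m0 x0 w dbar d k False) \<omega>
      - real_cond_exp M F (pJ A B Q R th N m0 x0 w dbar d k True) \<omega>)"

text \<open>VoI^pibar_k = e_k' A_k' Gamma_(k+1) A_k e_k - theta_k + rho^pibar_k.\<close>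
definition pVoI ::
  "'w measure \<Rightarrow> (nat \<Rightarrow> real^'n^'n) \<Rightarrow> (nat \<Rightarrow> real^'m^'n) \<Rightarrow> (nat \<Rightarrow> real^'n^'n) \<Rightarrow> (nat \<Rightarrow> real^'m^'m)
   \<Rightarrow> (nat \<Rightarrow> real) \<Rightarrow> nat \<Rightarrow> real^'n \<Rightarrow> ('w \<Rightarrow> real^'n) \<Rightarrow> (nat \<Rightarrow> 'w \<Rightarrow> real^'n)
   \<Rightarrow> (nat \<Rightarrow> bool) \<Rightarrow> (nat \<Rightarrow> 'w \<Rightarrow> bool) \<Rightarrow> nat \<Rightarrow> 'w \<Rightarrow> real" where
  "pVoI M A B Q R th N m0 x0 w dbar d k \<omega> =
     (let st = pcl A B (ricL A B Q R N) m0 x0 w d k \<omega>; e = fst st - snd st in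
      (A k *v e) \<bullet> (ricGamma A B Q R N (Suc k) *v (A k *v e)) - th k
      + prho M A B Q R th N m0 x0 w dbar d k \<omega>)"

text \<open>pi^+: delta^+_k = 1 iff VoI^pibar_k >= 0, evaluated along the closed loop of pi^+ itself.
  pplus_pre k holds the decisions at times < k.\<close>
primrec pplus_pre ::
  "'w measure \<Rightarrow> (nat \<Rightarrow> real^'n^'n) \<Rightarrow> (nat \<Rightarrow> real^'m^'n) \<Rightarrow> (nat \<Rightarrow> real^'n^'n) \<Rightarrow> (nat \<Rightarrow> real^'m^'m)
   \<Rightarrow> (nat \<Rightarrow> real) \<Rightarrow> nat \<Rightarrow> real^'n \<Rightarrow> ('w \<Rightarrow> real^'n) \<Rightarrow> (nat \<Rightarrow> 'w \<Rightarrow> real^'n)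
   \<Rightarrow> (nat \<Rightarrow> bool) \<Rightarrow> nat \<Rightarrow> nat \<Rightarrow> 'w \<Rightarrow> bool" where
  "pplus_pre M A B Q R th N m0 x0 w dbar 0 = (\<lambda>_ _. False)"
| "pplus_pre M A B Q R th N m0 x0 w dbar (Suc k) =
     (pplus_pre M A B Q R th N m0 x0 w dbar k)
       (k := (\<lambda>\<omega>. 0 \<le> pVoI M A B Q R th N m0 x0 w dbar (pplus_pre M A B Q R th N m0 x0 w dbar k) k \<omega>))"

definition pplus ::
  "'w measure \<Rightarrow> (nat \<Rightarrow> real^'n^'n) \<Rightarrow> (nat \<Rightarrow> real^'m^'n) \<Rightarrow> (nat \<Rightarrow> real^'n^'n) \<Rightarrow> (nat \<Rightarrow> real^'m^'m)
   \<Rightarrow> (nat \<Rightarrow> real) \<Rightarrow> nat \<Rightarrow> real^'n \<Rightarrow> ('w \<Rightarrow> real^'n) \<Rightarrow> (nat \<Rightarrow> 'w \<Rightarrow> real^'n)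
   \<Rightarrow> (nat \<Rightarrow> bool) \<Rightarrow> nat \<Rightarrow> 'w \<Rightarrow> bool" where
  "pplus M A B Q R th N m0 x0 w dbar k = pplus_pre M A B Q R th N m0 x0 w dbar (Suc k) k"

text \<open>Standing assumptions, perfect information setting.\<close>
definition perfect_model ::
  "'w measure \<Rightarrow> (nat \<Rightarrow> real^'n^'n) \<Rightarrow> (nat \<Rightarrow> real^'m^'n) \<Rightarrow> (nat \<Rightarrow> real^'n^'n) \<Rightarrow> (nat \<Rightarrow> real^'m^'m)
   \<Rightarrow> (nat \<Rightarrow> real^'n^'n) \<Rightarrow> (nat \<Rightarrow> real) \<Rightarrow> nat \<Rightarrow> real^'n \<Rightarrow> real^'n^'n
   \<Rightarrow> ('w \<Rightarrow> real^'n) \<Rightarrow> (nat \<Rightarrow> 'w \<Rightarrow> real^'n) \<Rightarrow> bool" where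
  "perfect_model M A B Q R W th N m0 M0 x0 w \<longleftrightarrow>
     prob_space M
     \<and> (\<forall>k\<le>Suc N. psd_mat (Q k))
     \<and> (\<forall>k\<le>N. pd_mat (R k) \<and> pd_mat (W k) \<and> 0 \<le> th k \<and> controllable (A k) (B k))
     \<and> psd_mat M0
     \<and> gaussian_rv M x0 m0 M0
     \<and> (\<forall>k\<le>N. gaussian_rv M (w k) 0 (W k))
     \<and> prob_space.indep_vars M (\<lambda>_. borel)
          (\<lambda>i. case i of X0 \<Rightarrow> x0 | Wn k \<Rightarrow> w k | Vn k \<Rightarrow> x0)
          (insert X0 (Wn ` {..N}))"

section \<open>Imperfect information\<close>

definition kgain ::
  "(nat \<Rightarrow> real^'n^'n) \<Rightarrow> (nat \<Rightarrow> real^'n^'p) \<Rightarrow> (nat \<Rightarrow> real^'p^'p) \<Rightarrow> nat \<Rightarrow> real^'n^'n \<Rightarrow> real^'p^'n" where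
  "kgain A C V k P = A k ** P ** transpose (C k) ** matrix_inv (C k ** P ** transpose (C k) + V k)"

text \<open>Closed loop (x_k, xhat_k, P_k) under trigger d and control u_k = - L_k xhat_k.\<close>
primrec icl ::
  "(nat \<Rightarrow> real^'n^'n) \<Rightarrow> (nat \<Rightarrow> real^'m^'n) \<Rightarrow> (nat \<Rightarrow> real^'n^'p) \<Rightarrow> (nat \<Rightarrow> real^'n^'n)
   \<Rightarrow> (nat \<Rightarrow> real^'p^'p) \<Rightarrow> (nat \<Rightarrow> real^'n^'m) \<Rightarrow> real^'n \<Rightarrow> real^'n^'n
   \<Rightarrow> ('w \<Rightarrow> real^'n) \<Rightarrow> (nat \<Rightarrow> 'w \<Rightarrow> real^'n) \<Rightarrow> (nat \<Rightarrow> 'w \<Rightarrow> real^'p) \<Rightarrow> (nat \<Rightarrow> 'w \<Rightarrow> bool)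
   \<Rightarrow> nat \<Rightarrow> 'w \<Rightarrow> (real^'n) \<times> (real^'n) \<times> (real^'n^'n)" where
  "icl A B C W V L m0 M0 x0 w v d 0 \<omega> = (x0 \<omega>, m0, M0)"
| "icl A B C W V L m0 M0 x0 w v d (Suc k) \<omega> =
     (let (x, xh, P) = icl A B C W V L m0 M0 x0 w v d k \<omega>;
          u = - (L k *v xh); y = C k *v x + v k \<omega>; K = kgain A C V k P in
      (A k *v x + B k *v u + w k \<omega>,
       A k *v xh + B k *v u + (if d k \<omega> then K *v (y - C k *v xh) else 0),
       A k ** P ** transpose (A k) + W k - (if d k \<omega> then K ** C k ** P ** transpose (A k) else 0)))"

definition icost ::
  "(nat \<Rightarrow> real^'n^'n) \<Rightarrow> (nat \<Rightarrow> real^'m^'n) \<Rightarrow> (nat \<Rightarrow> real^'n^'p) \<Rightarrow> (nat \<Rightarrow> real^'n^'n) \<Rightarrow> (nat \<Rightarrow> real^'p^'p)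
   \<Rightarrow> (nat \<Rightarrow> real^'n^'n) \<Rightarrow> (nat \<Rightarrow> real^'m^'m) \<Rightarrow> (nat \<Rightarrow> real) \<Rightarrow> nat \<Rightarrow> real^'n \<Rightarrow> real^'n^'n
   \<Rightarrow> ('w \<Rightarrow> real^'n) \<Rightarrow> (nat \<Rightarrow> 'w \<Rightarrow> real^'n) \<Rightarrow> (nat \<Rightarrow> 'w \<Rightarrow> real^'p) \<Rightarrow> (nat \<Rightarrow> 'w \<Rightarrow> bool)
   \<Rightarrow> 'w \<Rightarrow> real" where
  "icost A B C W V Q R th N m0 M0 x0 w v d \<omega> =
     (let L = ricL A B Q R N;
          x = (\<lambda>k. fst (icl A B C W V L m0 M0 x0 w v d k \<omega>));
          u = (\<lambda>k. - (L k *v fst (snd (icl A B C W V L m0 M0 x0 w v d k \<omega>)))) in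
      x (Suc N) \<bullet> (Q (Suc N) *v x (Suc N))
      + (\<Sum>k\<le>N. x k \<bullet> (Q k *v x k) + u k \<bullet> (R k *v u k) + th k * ind (d k \<omega>)))"

definition iPsi ::
  "'w measure \<Rightarrow> (nat \<Rightarrow> real^'n^'n) \<Rightarrow> (nat \<Rightarrow> real^'m^'n) \<Rightarrow> (nat \<Rightarrow> real^'n^'p) \<Rightarrow> (nat \<Rightarrow> real^'n^'n) \<Rightarrow> (nat \<Rightarrow> real^'p^'p)
   \<Rightarrow> (nat \<Rightarrow> real^'n^'n) \<Rightarrow> (nat \<Rightarrow> real^'m^'m) \<Rightarrow> (nat \<Rightarrow> real) \<Rightarrow> nat \<Rightarrow> real^'n \<Rightarrow> real^'n^'n
   \<Rightarrow> ('w \<Rightarrow> real^'n) \<Rightarrow> (nat \<Rightarrow> 'w \<Rightarrow> real^'n) \<Rightarrow> (nat \<Rightarrow> 'w \<Rightarrow> real^'p) \<Rightarrow> (nat \<Rightarrow> 'w \<Rightarrow> bool)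
   \<Rightarrow> ennreal" where
  "iPsi M A B C W V Q R th N m0 M0 x0 w v d =
     (\<integral>\<^sup>+ \<omega>. ennreal (icost A B C W V Q R th N m0 M0 x0 w v d \<omega>) \<partial>M)"

text \<open>sigma-algebra of I^e_k = {y_t : t <= k}, y_t = C_t x_t + v_t, under trigger d.\<close>
definition iinfo ::
  "'w measure \<Rightarrow> (nat \<Rightarrow> real^'n^'n) \<Rightarrow> (nat \<Rightarrow> real^'m^'n) \<Rightarrow> (nat \<Rightarrow> real^'n^'p) \<Rightarrow> (nat \<Rightarrow> real^'n^'n)
   \<Rightarrow> (nat \<Rightarrow> real^'p^'p) \<Rightarrow> (nat \<Rightarrow> real^'n^'m) \<Rightarrow> real^'n \<Rightarrow> real^'n^'n
   \<Rightarrow> ('w \<Rightarrow> real^'n) \<Rightarrow> (nat \<Rightarrow> 'w \<Rightarrow> real^'n) \<Rightarrow> (nat \<Rightarrow> 'w \<Rightarrow> real^'p) \<Rightarrow> (nat \<Rightarrow> 'w \<Rightarrow> bool)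
   \<Rightarrow> nat \<Rightarrow> 'w measure" where
  "iinfo M A B C W V L m0 M0 x0 w v d k =
     sigma (space M)
       (\<Union>t\<in>{..k}. {(\<lambda>\<omega>. C t *v fst (icl A B C W V L m0 M0 x0 w v d t \<omega>) + v t \<omega>) -` S \<inter> space M
                    | S. S \<in> sets borel})"

definition iJ ::
  "(nat \<Rightarrow> real^'n^'n) \<Rightarrow> (nat \<Rightarrow> real^'m^'n) \<Rightarrow> (nat \<Rightarrow> real^'n^'p) \<Rightarrow> (nat \<Rightarrow> real^'n^'n) \<Rightarrow> (nat \<Rightarrow> real^'p^'p)
   \<Rightarrow> (nat \<Rightarrow> real^'n^'n) \<Rightarrow> (nat \<Rightarrow> real^'m^'m) \<Rightarrow> (nat \<Rightarrow> real) \<Rightarrow> nat \<Rightarrow> real^'n \<Rightarrow> real^'n^'n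
   \<Rightarrow> ('w \<Rightarrow> real^'n) \<Rightarrow> (nat \<Rightarrow> 'w \<Rightarrow> real^'n) \<Rightarrow> (nat \<Rightarrow> 'w \<Rightarrow> real^'p)
   \<Rightarrow> (nat \<Rightarrow> bool) \<Rightarrow> (nat \<Rightarrow> 'w \<Rightarrow> bool) \<Rightarrow> nat \<Rightarrow> bool \<Rightarrow> 'w \<Rightarrow> real" where
  "iJ A B C W V Q R th N m0 M0 x0 w v dbar d k b \<omega> =
     (let G = ricGamma A B Q R N;
          st = (\<lambda>t. icl A B C W V (ricL A B Q R N) m0 M0 x0 w v (switch_at d k b dbar) t \<omega>);
          e = (\<lambda>t. fst (st t) - fst (snd (st t))) in
      (\<Sum>t\<in>{Suc k..N}. th t * ind (dbar t) + e (Suc t) \<bullet> (G (Suc t) *v e (Suc t))))"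

definition irho ::
  "'w measure \<Rightarrow> (nat \<Rightarrow> real^'n^'n) \<Rightarrow> (nat \<Rightarrow> real^'m^'n) \<Rightarrow> (nat \<Rightarrow> real^'n^'p) \<Rightarrow> (nat \<Rightarrow> real^'n^'n) \<Rightarrow> (nat \<Rightarrow> real^'p^'p)
   \<Rightarrow> (nat \<Rightarrow> real^'n^'n) \<Rightarrow> (nat \<Rightarrow> real^'m^'m) \<Rightarrow> (nat \<Rightarrow> real) \<Rightarrow> nat \<Rightarrow> real^'n \<Rightarrow> real^'n^'n
   \<Rightarrow> ('w \<Rightarrow> real^'n) \<Rightarrow> (nat \<Rightarrow> 'w \<Rightarrow> real^'n) \<Rightarrow> (nat \<Rightarrow> 'w \<Rightarrow> real^'p)
   \<Rightarrow> (nat \<Rightarrow> bool) \<Rightarrow> (nat \<Rightarrow> 'w \<Rightarrow> bool) \<Rightarrow> nat \<Rightarrow> 'w \<Rightarrow> real" where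
  "irho M A B C W V Q R th N m0 M0 x0 w v dbar d k \<omega> =
     (let F = iinfo M A B C W V (ricL A B Q R N) m0 M0 x0 w v d k in
      real_cond_exp M F (iJ A B C W V Q R th N m0 M0 x0 w v dbar d k False) \<omega>
      - real_cond_exp M F (iJ A B C W V Q R th N m0 M0 x0 w v dbar d k True) \<omega>)"

text \<open>VoI^pibar_k = nu_k' K_k' Gamma_(k+1) (2 A_k eps_k - K_k nu_k) - theta_k + rho^pibar_k, with
  xcheck_k = E[x_k | I^e_k] (componentwise conditional expectation), eps_k = xcheck_k - xhat_k,
  nu_k = y_k - C_k xhat_k, K_k = A_k P_k C_k' (C_k P_k C_k' + V_k)^-1.\<close>
definition iVoI ::
  "'w measure \<Rightarrow> (nat \<Rightarrow> real^'n^'n) \<Rightarrow> (nat \<Rightarrow> real^'m^'n) \<Rightarrow> (nat \<Rightarrow> real^'n^'p) \<Rightarrow> (nat \<Rightarrow> real^'n^'n) \<Rightarrow> (nat \<Rightarrow> real^'p^'p)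
   \<Rightarrow> (nat \<Rightarrow> real^'n^'n) \<Rightarrow> (nat \<Rightarrow> real^'m^'m) \<Rightarrow> (nat \<Rightarrow> real) \<Rightarrow> nat \<Rightarrow> real^'n \<Rightarrow> real^'n^'n
   \<Rightarrow> ('w \<Rightarrow> real^'n) \<Rightarrow> (nat \<Rightarrow> 'w \<Rightarrow> real^'n) \<Rightarrow> (nat \<Rightarrow> 'w \<Rightarrow> real^'p)
   \<Rightarrow> (nat \<Rightarrow> bool) \<Rightarrow> (nat \<Rightarrow> 'w \<Rightarrow> bool) \<Rightarrow> nat \<Rightarrow> 'w \<Rightarrow> real" where
  "iVoI M A B C W V Q R th N m0 M0 x0 w v dbar d k \<omega> =
     (let L = ricL A B Q R N;
          st = icl A B C W V L m0 M0 x0 w v d k \<omega>;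
          xh = fst (snd st); P = snd (snd st);
          F = iinfo M A B C W V L m0 M0 x0 w v d k;
          xc = (\<chi> i. real_cond_exp M F (\<lambda>\<omega>'. fst (icl A B C W V L m0 M0 x0 w v d k \<omega>') $ i) \<omega>);
          eps = xc - xh;
          nu = C k *v fst st + v k \<omega> - C k *v xh;
          K = kgain A C V k P in
      (K *v nu) \<bullet> (ricGamma A B Q R N (Suc k) *v (2 *\<^sub>R (A k *v eps) - K *v nu)) - th k
      + irho M A B C W V Q R th N m0 M0 x0 w v dbar d k \<omega>)"

primrec iplus_pre ::
  "'w measure \<Rightarrow> (nat \<Rightarrow> real^'n^'n) \<Rightarrow> (nat \<Rightarrow> real^'m^'n) \<Rightarrow> (nat \<Rightarrow> real^'n^'p) \<Rightarrow> (nat \<Rightarrow> real^'n^'n) \<Rightarrow> (nat \<Rightarrow> real^'p^'p)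
   \<Rightarrow> (nat \<Rightarrow> real^'n^'n) \<Rightarrow> (nat \<Rightarrow> real^'m^'m) \<Rightarrow> (nat \<Rightarrow> real) \<Rightarrow> nat \<Rightarrow> real^'n \<Rightarrow> real^'n^'n
   \<Rightarrow> ('w \<Rightarrow> real^'n) \<Rightarrow> (nat \<Rightarrow> 'w \<Rightarrow> real^'n) \<Rightarrow> (nat \<Rightarrow> 'w \<Rightarrow> real^'p)
   \<Rightarrow> (nat \<Rightarrow> bool) \<Rightarrow> nat \<Rightarrow> nat \<Rightarrow> 'w \<Rightarrow> bool" where
  "iplus_pre M A B C W V Q R th N m0 M0 x0 w v dbar 0 = (\<lambda>_ _. False)"
| "iplus_pre M A B C W V Q R th N m0 M0 x0 w v dbar (Suc k) =
     (iplus_pre M A B C W V Q R th N m0 M0 x0 w v dbar k)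
       (k := (\<lambda>\<omega>. 0 \<le> iVoI M A B C W V Q R th N m0 M0 x0 w v dbar
                          (iplus_pre M A B C W V Q R th N m0 M0 x0 w v dbar k) k \<omega>))"

definition iplus ::
  "'w measure \<Rightarrow> (nat \<Rightarrow> real^'n^'n) \<Rightarrow> (nat \<Rightarrow> real^'m^'n) \<Rightarrow> (nat \<Rightarrow> real^'n^'p) \<Rightarrow> (nat \<Rightarrow> real^'n^'n) \<Rightarrow> (nat \<Rightarrow> real^'p^'p)
   \<Rightarrow> (nat \<Rightarrow> real^'n^'n) \<Rightarrow> (nat \<Rightarrow> real^'m^'m) \<Rightarrow> (nat \<Rightarrow> real) \<Rightarrow> nat \<Rightarrow> real^'n \<Rightarrow> real^'n^'n
   \<Rightarrow> ('w \<Rightarrow> real^'n) \<Rightarrow> (nat \<Rightarrow> 'w \<Rightarrow> real^'n) \<Rightarrow> (nat \<Rightarrow> 'w \<Rightarrow> real^'p)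
   \<Rightarrow> (nat \<Rightarrow> bool) \<Rightarrow> nat \<Rightarrow> 'w \<Rightarrow> bool" where
  "iplus M A B C W V Q R th N m0 M0 x0 w v dbar k =
     iplus_pre M A B C W V Q R th N m0 M0 x0 w v dbar (Suc k) k"

text \<open>Additional standing assumptions of the imperfect information setting.\<close>
definition imperfect_model ::
  "'w measure \<Rightarrow> (nat \<Rightarrow> real^'n^'n) \<Rightarrow> (nat \<Rightarrow> real^'n^'p) \<Rightarrow> (nat \<Rightarrow> real^'p^'p) \<Rightarrow> nat
   \<Rightarrow> ('w \<Rightarrow> real^'n) \<Rightarrow> (nat \<Rightarrow> 'w \<Rightarrow> real^'n) \<Rightarrow> (nat \<Rightarrow> 'w \<Rightarrow> real^'p) \<Rightarrow> bool" where
  "imperfect_model M A C V N x0 w v \<longleftrightarrow>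
     (\<forall>k\<le>N. pd_mat (V k) \<and> observable (A k) (C k))
     \<and> (\<forall>k\<le>N. gaussian_rv M (v k) 0 (V k))
     \<and> prob_space.indep_vars M (\<lambda>_. borel)
          (\<lambda>i. case i of X0 \<Rightarrow> (\<lambda>\<omega>. (x0 \<omega>, 0 :: real^'p))
                      | Wn k \<Rightarrow> (\<lambda>\<omega>. (w k \<omega>, 0 :: real^'p))
                      | Vn k \<Rightarrow> (\<lambda>\<omega>. (0 :: real^'n, v k \<omega>)))
          (insert X0 (Wn ` {..N} \<union> Vn ` {..N}))"

end

theory Submission
  imports Defs
begin

text \<open>Completing the square along the Riccati recursion shows that, for every trigger adapted to the
  information of the event trigger, the expected cost under \<open>u_k = - L_k xhat_k\<close> is a constant plus
  the expectation of \<open>\<Sum>k\<le>N. \<theta>_k \<delta>_k + e_(k+1)' \<Gamma>_(k+1) e_(k+1)\<close>; the cross terms vanish because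
  \<open>w_k\<close> is a martingale difference. Let \<open>\<pi>_j\<close> follow \<open>\<pi>\<^sup>+\<close> before time \<open>j\<close> and the periodic policy
  from \<open>j\<close> on. Then \<open>\<pi>_(j+1)\<close> and \<open>\<pi>_j\<close> differ only in the decision at time \<open>j\<close>, and \<open>VoI_j\<close> is
  exactly the conditional expectation, given the trigger's information, of the cost of deciding \<open>0\<close>
  minus the cost of deciding \<open>1\<close>. Hence thresholding \<open>VoI_j\<close> at \<open>0\<close> cannot increase the cost, and
  the comparisons telescope from the periodic policy to \<open>\<pi>\<^sup>+\<close>. No optimality of the Kalman gain is
  involved, so perfect information is the special case of noiseless observation of the whole state.\<close>

section \<open>Symmetric and positive definite matrices\<close>

lemma inner_transpose_matrix_vector_mult:
  fixes A :: "real^'n^'m"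
  shows "x \<bullet> (transpose A *v y) = (A *v x) \<bullet> y"
  by (metis dot_lmul_matrix inner_commute transpose_matrix_vector)

lemma transpose_eq_self_iff:
  fixes S :: "real^'n^'n"
  shows "transpose S = S \<longleftrightarrow> (\<forall>x y. x \<bullet> (S *v y) = y \<bullet> (S *v x))"
proof
  assume "transpose S = S"
  then show "\<forall>x y. x \<bullet> (S *v y) = y \<bullet> (S *v x)"
    by (metis inner_transpose_matrix_vector_mult inner_commute)
next
  assume swap: "\<forall>x y. x \<bullet> (S *v y) = y \<bullet> (S *v x)"
  have "x \<bullet> (transpose S *v y) = x \<bullet> (S *v y)" for x y
    using swap by (metis inner_transpose_matrix_vector_mult inner_commute)
  then show "transpose S = S"
    unfolding matrix_eq by (metis vector_eq_ldot)
qed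

lemma symmetric_quadratic_add:
  fixes S :: "real^'n^'n"
  assumes "transpose S = S"
  shows "(x + y) \<bullet> (S *v (x + y)) = x \<bullet> (S *v x) + 2 * (y \<bullet> (S *v x)) + y \<bullet> (S *v y)"
proof -
  have "x \<bullet> (S *v y) = y \<bullet> (S *v x)"
    using assms unfolding transpose_eq_self_iff by blast
  then show ?thesis
    by (simp add: matrix_vector_right_distrib inner_add_left inner_add_right)
qed

lemma symmetric_quadratic_diff:
  fixes S :: "real^'n^'n"
  assumes "transpose S = S"
  shows "x \<bullet> (S *v x) - (x - y) \<bullet> (S *v (x - y)) = y \<bullet> (S *v (2 *\<^sub>R x - y))"
proof -
  have "x \<bullet> (S *v y) = y \<bullet> (S *v x)"
    using assms unfolding transpose_eq_self_iff by blast
  then show ?thesis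
    by (simp add: matrix_vector_mult_diff_distrib matrix_vector_mult_scaleR
        inner_diff_left inner_diff_right)
qed

lemma matrix_inv_right:
  fixes A :: "real^'n^'n"
  assumes "invertible A"
  shows "A ** matrix_inv A = mat 1"
proof -
  obtain A' where "A ** A' = mat 1 \<and> A' ** A = mat 1"
    using assms unfolding invertible_def by blast
  then have "A ** matrix_inv A = mat 1 \<and> matrix_inv A ** A = mat 1"
    unfolding matrix_inv_def by (rule someI)
  then show ?thesis ..
qed

lemma pd_mat_invertible:
  assumes "pd_mat S"
  shows "invertible S"
proof -
  have "\<forall>x. S *v x = 0 \<longrightarrow> x = 0"
    using assms unfolding pd_mat_def by (metis inner_zero_right less_irrefl)
  then show ?thesis
    using matrix_left_invertible_ker[of S] invertible_left_inverse[of S] by blast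
qed

lemma pd_mat_imp_psd_mat: "pd_mat S \<Longrightarrow> psd_mat S"
  unfolding pd_mat_def psd_mat_def by (metis inner_zero_left less_eq_real_def)

lemma pd_mat_identity: "pd_mat (mat 1)"
  by (simp add: pd_mat_def)

lemma psd_mat_congruence:
  fixes S :: "real^'n^'n" and B :: "real^'m^'n"
  assumes "psd_mat S"
  shows "psd_mat (transpose B ** S ** B)"
  using assms unfolding psd_mat_def
  by (auto simp: matrix_transpose_mul matrix_mul_assoc inner_transpose_matrix_vector_mult
      simp flip: matrix_vector_mul_assoc simp del: transpose_matrix_vector)

lemma pd_mat_psd_add:
  assumes "psd_mat S" "pd_mat R"
  shows "pd_mat (S + R)"
  using assms unfolding psd_mat_def pd_mat_def transpose_eq_self_iff
  by (auto simp: matrix_vector_mult_add_rdistrib inner_add_right add_nonneg_pos)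

section \<open>Riccati recursion\<close>

locale lq_system =
  fixes A :: "nat \<Rightarrow> real^'n^'n" and B :: "nat \<Rightarrow> real^'m^'n"
    and Q :: "nat \<Rightarrow> real^'n^'n" and R :: "nat \<Rightarrow> real^'m^'m" and N :: nat
begin

abbreviation "S \<equiv> ricS A B Q R N"
abbreviation "L \<equiv> ricL A B Q R N"
abbreviation "\<Gamma> \<equiv> ricGamma A B Q R N"
abbreviation "input_weight k \<equiv> transpose (B k) ** S (Suc k) ** B k + R k"

lemma S_end: "S (Suc N) = Q (Suc N)"
  by (simp add: ricS_def)

lemma S_rec:
  assumes "k \<le> N"
  shows "S k = Q k + transpose (A k) ** S (Suc k) ** A k - \<Gamma> k"
proof -
  have "Suc N - k = Suc (N - k)" "N - (N - k) = k" "Suc N - Suc k = N - k"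
    using assms by auto
  then show ?thesis
    using assms by (simp add: ricS_def riccati_step_def ricGamma_def Let_def)
qed

lemma Gamma_end: "\<Gamma> (Suc N) = 0"
  by (simp add: ricGamma_def)

end

locale riccati = lq_system A B Q R N
  for A :: "nat \<Rightarrow> real^'n^'n" and B :: "nat \<Rightarrow> real^'m^'n"
    and Q :: "nat \<Rightarrow> real^'n^'n" and R :: "nat \<Rightarrow> real^'m^'m" and N :: nat +
  assumes Q_psd: "k \<le> Suc N \<Longrightarrow> psd_mat (Q k)"
    and R_pd: "k \<le> N \<Longrightarrow> pd_mat (R k)"
begin

lemma input_weight_pd:
  assumes "k \<le> N" "psd_mat (S (Suc k))"
  shows "pd_mat (input_weight k)"
  using assms R_pd by (intro pd_mat_psd_add psd_mat_congruence) auto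

lemma input_weight_L:
  assumes "k \<le> N" "psd_mat (S (Suc k))"
  shows "input_weight k ** L k = transpose (B k) ** S (Suc k) ** A k"
proof -
  have "input_weight k ** L k
      = input_weight k ** matrix_inv (input_weight k) ** transpose (B k) ** S (Suc k) ** A k"
    by (simp add: ricL_def Let_def matrix_mul_assoc)
  then show ?thesis
    using matrix_inv_right[OF pd_mat_invertible[OF input_weight_pd[OF assms]]] by simp
qed

lemma Gamma_eq_congruence:
  assumes "k \<le> N" "psd_mat (S (Suc k))"
  shows "\<Gamma> k = transpose (L k) ** input_weight k ** L k"
proof -
  have sym: "transpose (S (Suc k)) = S (Suc k)" "transpose (input_weight k) = input_weight k"
    using assms(2) input_weight_pd[OF assms] by (auto simp: psd_mat_def pd_mat_def)
  have "\<Gamma> k = transpose (A k) ** S (Suc k) ** B k ** L k"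
    using assms(1) by (simp add: ricGamma_def ricL_def Let_def matrix_mul_assoc)
  also have "transpose (A k) ** S (Suc k) ** B k
      = transpose (transpose (B k) ** S (Suc k) ** A k)"
    by (simp add: matrix_transpose_mul matrix_mul_assoc sym(1))
  also have "\<dots> = transpose (L k) ** input_weight k"
    by (simp only: input_weight_L[OF assms, symmetric] matrix_transpose_mul sym(2))
  finally show ?thesis .
qed

lemma Gamma_psd_step:
  assumes "k \<le> N" "psd_mat (S (Suc k))"
  shows "psd_mat (\<Gamma> k)"
  unfolding Gamma_eq_congruence[OF assms]
  by (rule psd_mat_congruence[OF pd_mat_imp_psd_mat[OF input_weight_pd[OF assms]]])

lemma Gamma_quadratic_form:
  assumes "k \<le> N" "psd_mat (S (Suc k))"
  shows "x \<bullet> (\<Gamma> k *v x) = (L k *v x) \<bullet> (input_weight k *v (L k *v x))"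
  by (simp add: Gamma_eq_congruence[OF assms] inner_transpose_matrix_vector_mult
      flip: matrix_vector_mul_assoc del: transpose_matrix_vector)

lemma completion_of_squares_step:
  assumes "k \<le> N" "psd_mat (S (Suc k))"
  shows "x \<bullet> (Q k *v x) + u \<bullet> (R k *v u)
           + (A k *v x + B k *v u) \<bullet> (S (Suc k) *v (A k *v x + B k *v u))
         = x \<bullet> (S k *v x) + (u + L k *v x) \<bullet> (input_weight k *v (u + L k *v x))"
proof -
  let ?G = "input_weight k"
  have S_sym: "transpose (S (Suc k)) = S (Suc k)" and G_sym: "transpose ?G = ?G"
    using assms(2) input_weight_pd[OF assms] by (auto simp: psd_mat_def pd_mat_def)
  have state_form: "x \<bullet> (S k *v x)
      = x \<bullet> (Q k *v x) + (A k *v x) \<bullet> (S (Suc k) *v (A k *v x)) - (L k *v x) \<bullet> (?G *v (L k *v x))"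
    unfolding Gamma_quadratic_form[OF assms, symmetric]
    by (simp add: S_rec[OF assms(1)] matrix_vector_mult_add_rdistrib
        matrix_vector_mult_diff_rdistrib inner_add_right inner_diff_right
        inner_transpose_matrix_vector_mult
        flip: matrix_vector_mul_assoc del: transpose_matrix_vector)
  have input_form: "u \<bullet> (?G *v u) = (B k *v u) \<bullet> (S (Suc k) *v (B k *v u)) + u \<bullet> (R k *v u)"
    by (simp add: matrix_vector_mult_add_rdistrib inner_add_right inner_transpose_matrix_vector_mult
        flip: matrix_vector_mul_assoc del: transpose_matrix_vector)
  have "?G *v (L k *v x) = transpose (B k) *v (S (Suc k) *v (A k *v x))"
    by (simp only: matrix_vector_mul_assoc input_weight_L[OF assms] matrix_mul_assoc)
  then have mixed_form: "u \<bullet> (?G *v (L k *v x)) = (B k *v u) \<bullet> (S (Suc k) *v (A k *v x))"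
    by (simp only: inner_transpose_matrix_vector_mult)
  moreover have "(L k *v x) \<bullet> (?G *v u) = u \<bullet> (?G *v (L k *v x))"
    using G_sym unfolding transpose_eq_self_iff by blast
  ultimately show ?thesis
    using state_form input_form symmetric_quadratic_add[OF S_sym, of "A k *v x" "B k *v u"]
      symmetric_quadratic_add[OF G_sym, of u "L k *v x"]
    by argo
qed

lemma S_psd:
  assumes "k \<le> Suc N"
  shows "psd_mat (S k)"
  using assms
proof (induction k rule: inc_induct)
  case base
  then show ?case using Q_psd by (simp add: S_end)
next
  case (step k)
  then have k: "k \<le> N" "psd_mat (S (Suc k))" by auto
  note Q = Q_psd[OF le_SucI[OF k(1)]]
  have "transpose (S k) = S k"
    using Q Gamma_psd_step[OF k] psd_mat_congruence[OF k(2), of "A k"]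
    unfolding S_rec[OF k(1)] psd_mat_def transpose_eq_self_iff
    by (simp add: matrix_vector_mult_add_rdistrib matrix_vector_mult_diff_rdistrib
        inner_add_right inner_diff_right)
  moreover have "0 \<le> x \<bullet> (S k *v x)" for x
  proof -
    let ?u = "- (L k *v x)" and ?z = "A k *v x + B k *v (- (L k *v x))"
    have "x \<bullet> (S k *v x) = x \<bullet> (Q k *v x) + ?u \<bullet> (R k *v ?u) + ?z \<bullet> (S (Suc k) *v ?z)"
      using completion_of_squares_step[OF k, of x ?u] by simp
    moreover have "0 \<le> x \<bullet> (Q k *v x)" "0 \<le> ?u \<bullet> (R k *v ?u)" "0 \<le> ?z \<bullet> (S (Suc k) *v ?z)"
      using Q pd_mat_imp_psd_mat[OF R_pd[OF k(1)]] k(2) unfolding psd_mat_def by blast+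
    ultimately show ?thesis by linarith
  qed
  ultimately show ?case by (simp add: psd_mat_def)
qed

lemma Gamma_psd:
  assumes "k \<le> Suc N"
  shows "psd_mat (\<Gamma> k)"
proof (cases "k = Suc N")
  case True
  then show ?thesis by (simp add: Gamma_end psd_mat_def transpose_eq_self_iff)
next
  case False
  then show ?thesis using assms by (intro Gamma_psd_step S_psd) auto
qed

text \<open>Here \<open>z\<close> plays the role of the estimate \<open>xhat_k\<close> and \<open>w\<close> that of the process noise.\<close>

lemma stage_cost_identity:
  assumes "k \<le> N" and u: "u = - (L k *v z)"
  shows "x \<bullet> (Q k *v x) + u \<bullet> (R k *v u)
           + (A k *v x + B k *v u + w) \<bullet> (S (Suc k) *v (A k *v x + B k *v u + w))
         = x \<bullet> (S k *v x) + (x - z) \<bullet> (\<Gamma> k *v (x - z))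
           + 2 * (w \<bullet> (S (Suc k) *v (A k *v x + B k *v u))) + w \<bullet> (S (Suc k) *v w)"
proof -
  have S: "psd_mat (S (Suc k))" using assms(1) by (intro S_psd) simp
  then have sym: "transpose (S (Suc k)) = S (Suc k)" by (simp add: psd_mat_def)
  have "u + L k *v x = L k *v (x - z)"
    by (simp add: u matrix_vector_mult_diff_distrib)
  then have "(u + L k *v x) \<bullet> (input_weight k *v (u + L k *v x)) = (x - z) \<bullet> (\<Gamma> k *v (x - z))"
    by (simp only: Gamma_quadratic_form[OF assms(1) S])
  then show ?thesis
    using completion_of_squares_step[OF assms(1) S, of x u]
      symmetric_quadratic_add[OF sym, of "A k *v x + B k *v u" w] by linarith
qed

end

section \<open>Square-integrable random vectors\<close>

lemma borel_measurable_bounded_linear: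
  "bounded_linear f \<Longrightarrow> X \<in> borel_measurable M \<Longrightarrow> (\<lambda>\<omega>. f (X \<omega>)) \<in> borel_measurable M"
  by (rule measurable_compose[OF _ borel_measurable_continuous_onI[OF linear_continuous_on]])

lemmas borel_measurable_matrix_vector_mult [measurable (raw)] =
  borel_measurable_bounded_linear[OF matrix_vector_mul_bounded_linear]

definition sq_integrable :: "'w measure \<Rightarrow> ('w \<Rightarrow> 'a::euclidean_space) \<Rightarrow> bool" where
  "sq_integrable M X \<longleftrightarrow> X \<in> borel_measurable M \<and> integrable M (\<lambda>\<omega>. (norm (X \<omega>))\<^sup>2)"

lemma sq_integrable_measurable [measurable_dest]: "sq_integrable M X \<Longrightarrow> X \<in> borel_measurable M"
  by (simp add: sq_integrable_def)

lemma (in finite_measure) sq_integrable_const: "sq_integrable M (\<lambda>_. c)"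
  by (simp add: sq_integrable_def)

lemma sq_integrable_bound:
  fixes X :: "'w \<Rightarrow> 'a::euclidean_space" and Y :: "'w \<Rightarrow> 'b::euclidean_space"
  assumes X: "sq_integrable M X" and Y: "Y \<in> borel_measurable M"
    and le: "\<And>\<omega>. norm (Y \<omega>) \<le> c * norm (X \<omega>)"
  shows "sq_integrable M Y"
  unfolding sq_integrable_def
proof (intro conjI Y, rule Bochner_Integration.integrable_bound)
  show "integrable M (\<lambda>\<omega>. c\<^sup>2 * (norm (X \<omega>))\<^sup>2)"
    using X by (simp add: sq_integrable_def)
  show "(\<lambda>\<omega>. (norm (Y \<omega>))\<^sup>2) \<in> borel_measurable M"
    using Y by measurable
  show "AE \<omega> in M. norm ((norm (Y \<omega>))\<^sup>2) \<le> norm (c\<^sup>2 * (norm (X \<omega>))\<^sup>2)"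
    using power_mono[OF le norm_ge_zero, of _ 2] by (simp add: power_mult_distrib)
qed

lemma sq_integrable_bounded_linear:
  assumes f: "bounded_linear f" and X: "sq_integrable M X"
  shows "sq_integrable M (\<lambda>\<omega>. f (X \<omega>))"
  using X
proof (rule sq_integrable_bound[where c = "onorm f"])
  show "(\<lambda>\<omega>. f (X \<omega>)) \<in> borel_measurable M"
    by (rule borel_measurable_bounded_linear[OF f sq_integrable_measurable[OF X]])
qed (rule onorm[OF f])

lemmas sq_integrable_matrix_vector_mult =
  sq_integrable_bounded_linear[OF matrix_vector_mul_bounded_linear]
lemmas sq_integrable_scaleR = sq_integrable_bounded_linear[OF bounded_linear_scaleR_right]
lemmas sq_integrable_uminus =
  sq_integrable_bounded_linear[OF bounded_linear_minus[OF bounded_linear_ident]]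
lemmas sq_integrable_inner_left = sq_integrable_bounded_linear[OF bounded_linear_inner_left]

lemma integrable_inner:
  assumes X: "sq_integrable M X" and Y: "sq_integrable M Y"
  shows "integrable M (\<lambda>\<omega>. X \<omega> \<bullet> Y \<omega>)"
proof (rule Bochner_Integration.integrable_bound)
  show "integrable M (\<lambda>\<omega>. (norm (X \<omega>))\<^sup>2 + (norm (Y \<omega>))\<^sup>2)"
    using assms by (simp add: sq_integrable_def)
  show "(\<lambda>\<omega>. X \<omega> \<bullet> Y \<omega>) \<in> borel_measurable M"
    using X Y by measurable
  have "\<bar>x \<bullet> y\<bar> \<le> (norm x)\<^sup>2 + (norm y)\<^sup>2" for x y :: 'b
    using Cauchy_Schwarz_ineq2[of x y] sum_squares_bound[of "norm x" "norm y"]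
      mult_nonneg_nonneg[OF norm_ge_zero[of x] norm_ge_zero[of y]] by linarith
  then show "AE \<omega> in M. norm (X \<omega> \<bullet> Y \<omega>) \<le> norm ((norm (X \<omega>))\<^sup>2 + (norm (Y \<omega>))\<^sup>2)"
    by simp
qed

lemma sq_integrable_add:
  assumes X: "sq_integrable M X" and Y: "sq_integrable M Y"
  shows "sq_integrable M (\<lambda>\<omega>. X \<omega> + Y \<omega>)"
  unfolding sq_integrable_def
proof
  have "(\<lambda>\<omega>. (norm (X \<omega> + Y \<omega>))\<^sup>2)
      = (\<lambda>\<omega>. X \<omega> \<bullet> X \<omega> + Y \<omega> \<bullet> X \<omega> + (X \<omega> \<bullet> Y \<omega> + Y \<omega> \<bullet> Y \<omega>))"
    by (simp add: power2_norm_eq_inner inner_add_left inner_add_right)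
  then show "integrable M (\<lambda>\<omega>. (norm (X \<omega> + Y \<omega>))\<^sup>2)"
    by (simp only:) (intro Bochner_Integration.integrable_add integrable_inner X Y)
qed (use X Y in measurable)

lemma sq_integrable_diff:
  assumes "sq_integrable M X" "sq_integrable M Y"
  shows "sq_integrable M (\<lambda>\<omega>. X \<omega> - Y \<omega>)"
  using sq_integrable_add[OF assms(1) sq_integrable_uminus[OF assms(2)]] by simp

lemma sq_integrable_if:
  assumes X: "sq_integrable M X" and Y: "sq_integrable M Y" and [measurable]: "Measurable.pred M P"
  shows "sq_integrable M (\<lambda>\<omega>. if P \<omega> then X \<omega> else Y \<omega>)"
  unfolding sq_integrable_def
proof
  show meas: "(\<lambda>\<omega>. if P \<omega> then X \<omega> else Y \<omega>) \<in> borel_measurable M"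
    using X Y by measurable
  show "integrable M (\<lambda>\<omega>. (norm (if P \<omega> then X \<omega> else Y \<omega>))\<^sup>2)"
  proof (rule Bochner_Integration.integrable_bound)
    show "integrable M (\<lambda>\<omega>. (norm (X \<omega>))\<^sup>2 + (norm (Y \<omega>))\<^sup>2)"
      using X Y by (simp add: sq_integrable_def)
    show "(\<lambda>\<omega>. (norm (if P \<omega> then X \<omega> else Y \<omega>))\<^sup>2) \<in> borel_measurable M"
      using meas by measurable
  qed auto
qed

lemma sq_integrable_componentwise:
  fixes X :: "'w \<Rightarrow> 'a::euclidean_space"
  assumes "\<And>b. b \<in> Basis \<Longrightarrow> sq_integrable M (\<lambda>\<omega>. X \<omega> \<bullet> b)"
  shows "sq_integrable M X"
  unfolding sq_integrable_def
proof
  show "X \<in> borel_measurable M"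
    using assms by (subst borel_measurable_euclidean_space) (simp add: sq_integrable_def)
  have norm_sq: "(norm x)\<^sup>2 = (\<Sum>b\<in>Basis. (x \<bullet> b)\<^sup>2)" for x :: 'a
    unfolding power2_norm_eq_inner by (subst euclidean_inner) (simp add: power2_eq_square)
  have "integrable M (\<lambda>\<omega>. \<Sum>b\<in>Basis. (X \<omega> \<bullet> b)\<^sup>2)"
    using assms by (intro Bochner_Integration.integrable_sum) (simp add: sq_integrable_def)
  then show "integrable M (\<lambda>\<omega>. (norm (X \<omega>))\<^sup>2)"
    by (simp only: norm_sq)
qed

lemma (in finite_measure) sq_integrable_imp_integrable:
  assumes "sq_integrable M X"
  shows "integrable M X"
proof (rule integrable_norm_cancel)
  show "integrable M (\<lambda>\<omega>. norm (X \<omega>))"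
    by (rule square_integrable_imp_integrable) (use assms in \<open>auto simp: sq_integrable_def\<close>)
qed (use assms in measurable)

section \<open>Conditional expectation of random vectors\<close>

definition cond_exp_version ::
  "'w measure \<Rightarrow> 'w measure \<Rightarrow> ('w \<Rightarrow> 'a::euclidean_space) \<Rightarrow> ('w \<Rightarrow> 'a) \<Rightarrow> bool" where
  "cond_exp_version M F X Z \<longleftrightarrow> Z \<in> borel_measurable F \<and>
     (\<forall>b\<in>Basis. AE \<omega> in M. real_cond_exp M F (\<lambda>\<omega>. X \<omega> \<bullet> b) \<omega> = Z \<omega> \<bullet> b)"

lemma cond_exp_version_measurable [measurable_dest]:
  "cond_exp_version M F X Z \<Longrightarrow> Z \<in> borel_measurable F"
  by (simp add: cond_exp_version_def)

lemma cond_exp_version_vec_lambda: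
  fixes X :: "'w \<Rightarrow> real^'n"
  shows "cond_exp_version M F X (\<lambda>\<omega>. \<chi> i. real_cond_exp M F (\<lambda>\<omega>. X \<omega> $ i) \<omega>)"
  unfolding cond_exp_version_def
  by (subst borel_measurable_euclidean_space) (auto simp: Basis_vec_def inner_axis)

context sigma_finite_subalgebra
begin

lemma cond_exp_version_self:
  assumes "integrable M X" "X \<in> borel_measurable F"
  shows "cond_exp_version M F X X"
  unfolding cond_exp_version_def
  using assms by (auto intro!: borel_measurable_inner)

lemma cond_exp_version_tower:
  assumes sub: "subalgebra M G" "subalgebra G F"
    and X: "integrable M X" and Z: "cond_exp_version M G X Z" and Y: "cond_exp_version M F Z Y"
  shows "cond_exp_version M F X Y"
  unfolding cond_exp_version_def
proof (intro conjI ballI)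
  fix b :: 'b assume b: "b \<in> Basis"
  have Xb: "integrable M (\<lambda>\<omega>. X \<omega> \<bullet> b)" using X by simp
  have [measurable]: "Z \<in> borel_measurable M"
    by (rule measurable_from_subalg[OF sub(1) cond_exp_version_measurable[OF Z]])
  have "AE \<omega> in M. real_cond_exp M F (real_cond_exp M G (\<lambda>\<omega>. X \<omega> \<bullet> b)) \<omega>
      = real_cond_exp M F (\<lambda>\<omega>. Z \<omega> \<bullet> b) \<omega>"
    using Z b by (intro real_cond_exp_cong) (auto simp: cond_exp_version_def)
  moreover have "AE \<omega> in M. real_cond_exp M F (real_cond_exp M G (\<lambda>\<omega>. X \<omega> \<bullet> b)) \<omega>
      = real_cond_exp M F (\<lambda>\<omega>. X \<omega> \<bullet> b) \<omega>"
    by (rule real_cond_exp_nested_subalg[OF sub Xb])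
  moreover have "AE \<omega> in M. real_cond_exp M F (\<lambda>\<omega>. Z \<omega> \<bullet> b) \<omega> = Y \<omega> \<bullet> b"
    using Y b by (simp add: cond_exp_version_def)
  ultimately show "AE \<omega> in M. real_cond_exp M F (\<lambda>\<omega>. X \<omega> \<bullet> b) \<omega> = Y \<omega> \<bullet> b"
    by eventually_elim simp
qed (rule cond_exp_version_measurable[OF Y])

lemma real_cond_exp_inner:
  assumes h [measurable]: "h \<in> borel_measurable F" and X [measurable]: "X \<in> borel_measurable M"
    and int: "\<And>b. integrable M (\<lambda>\<omega>. (h \<omega> \<bullet> b) * (X \<omega> \<bullet> b))" and Z: "cond_exp_version M F X Z"
  shows "AE \<omega> in M. real_cond_exp M F (\<lambda>\<omega>. h \<omega> \<bullet> X \<omega>) \<omega> = h \<omega> \<bullet> Z \<omega>"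
proof -
  let ?E = "real_cond_exp M F"
  have "AE \<omega> in M. ?E (\<lambda>\<omega>. h \<omega> \<bullet> X \<omega>) \<omega> = (\<Sum>b\<in>Basis. ?E (\<lambda>\<omega>. (h \<omega> \<bullet> b) * (X \<omega> \<bullet> b)) \<omega>)"
    using real_cond_exp_sum[OF int, where I = Basis] by (simp only: euclidean_inner[of "h _" "X _"])
  moreover have "AE \<omega> in M. \<forall>b\<in>Basis. ?E (\<lambda>\<omega>. (h \<omega> \<bullet> b) * (X \<omega> \<bullet> b)) \<omega>
      = (h \<omega> \<bullet> b) * ?E (\<lambda>\<omega>. X \<omega> \<bullet> b) \<omega>"
    using int by (intro AE_finite_allI finite_Basis real_cond_exp_mult) measurable
  moreover have "AE \<omega> in M. \<forall>b\<in>Basis. ?E (\<lambda>\<omega>. X \<omega> \<bullet> b) \<omega> = Z \<omega> \<bullet> b"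
    using Z by (intro AE_finite_allI finite_Basis) (simp add: cond_exp_version_def)
  ultimately show ?thesis
    by eventually_elim (simp add: euclidean_inner[of "h _" "Z _"])
qed

lemma real_cond_exp_inner_sq_integrable:
  assumes h: "h \<in> borel_measurable F" "sq_integrable M h" and X: "sq_integrable M X"
    and Z: "cond_exp_version M F X Z"
  shows "AE \<omega> in M. real_cond_exp M F (\<lambda>\<omega>. h \<omega> \<bullet> X \<omega>) \<omega> = h \<omega> \<bullet> Z \<omega>"
proof (rule real_cond_exp_inner[OF h(1) sq_integrable_measurable[OF X] _ Z])
  show "integrable M (\<lambda>\<omega>. (h \<omega> \<bullet> b) * (X \<omega> \<bullet> b))" for b
    using integrable_inner[OF sq_integrable_inner_left[OF h(2)] sq_integrable_inner_left[OF X]]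
    by simp
qed

lemma cond_exp_version_bounded_linear:
  fixes f :: "'b::euclidean_space \<Rightarrow> 'c::euclidean_space"
  assumes f: "bounded_linear f" and X: "integrable M X" and Z: "cond_exp_version M F X Z"
  shows "cond_exp_version M F (\<lambda>\<omega>. f (X \<omega>)) (\<lambda>\<omega>. f (Z \<omega>))"
  unfolding cond_exp_version_def
proof (intro conjI ballI)
  show "(\<lambda>\<omega>. f (Z \<omega>)) \<in> borel_measurable F"
    by (rule borel_measurable_bounded_linear[OF f cond_exp_version_measurable[OF Z]])
  fix b :: 'c
  have adjoint: "f x \<bullet> b = adjoint f b \<bullet> x" for x
    using adjoint_works[OF bounded_linear.linear[OF f]] by (simp add: inner_commute)
  show "AE \<omega> in M. real_cond_exp M F (\<lambda>\<omega>. f (X \<omega>) \<bullet> b) \<omega> = f (Z \<omega>) \<bullet> b"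
    unfolding adjoint using X Z by (intro real_cond_exp_inner) simp_all
qed

lemma cond_exp_version_add:
  assumes X: "integrable M X" "cond_exp_version M F X Z"
    and Y: "integrable M Y" "cond_exp_version M F Y U"
  shows "cond_exp_version M F (\<lambda>\<omega>. X \<omega> + Y \<omega>) (\<lambda>\<omega>. Z \<omega> + U \<omega>)"
  unfolding cond_exp_version_def inner_add_left
proof (intro conjI ballI)
  show "(\<lambda>\<omega>. Z \<omega> + U \<omega>) \<in> borel_measurable F"
    by (rule borel_measurable_add[OF cond_exp_version_measurable[OF X(2)]
        cond_exp_version_measurable[OF Y(2)]])
  fix b :: 'b assume "b \<in> Basis"
  then have "AE \<omega> in M. real_cond_exp M F (\<lambda>\<omega>. X \<omega> \<bullet> b) \<omega> = Z \<omega> \<bullet> b"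
    "AE \<omega> in M. real_cond_exp M F (\<lambda>\<omega>. Y \<omega> \<bullet> b) \<omega> = U \<omega> \<bullet> b"
    using X(2) Y(2) by (auto simp: cond_exp_version_def)
  with real_cond_exp_add[OF integrable_inner_left[OF X(1)] integrable_inner_left[OF Y(1)], of b b]
  show "AE \<omega> in M. real_cond_exp M F (\<lambda>\<omega>. X \<omega> \<bullet> b + Y \<omega> \<bullet> b) \<omega> = Z \<omega> \<bullet> b + U \<omega> \<bullet> b"
    by eventually_elim simp
qed

lemma cond_exp_version_diff:
  assumes X: "integrable M X" "cond_exp_version M F X Z"
    and Y: "integrable M Y" "cond_exp_version M F Y U"
  shows "cond_exp_version M F (\<lambda>\<omega>. X \<omega> - Y \<omega>) (\<lambda>\<omega>. Z \<omega> - U \<omega>)"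
  using cond_exp_version_add[OF X _ cond_exp_version_bounded_linear[OF
      bounded_linear_minus[OF bounded_linear_ident] Y]] Y(1) by simp

text \<open>The loss \<open>f b - f P\<close> against the constant decision \<open>b\<close> is \<open>s * gap\<close> with the
  \<open>F\<close>-measurable sign \<open>s = of_bool P - of_bool b\<close>, so that \<open>gap\<close> may be replaced by its
  conditional expectation \<open>V\<close>, and \<open>s * V \<ge> 0\<close>.\<close>

lemma integral_threshold_decision_le:
  fixes f :: "bool \<Rightarrow> 'a \<Rightarrow> real"
  assumes f: "\<And>b. integrable M (f b)"
    and V: "AE \<omega> in M. real_cond_exp M F (\<lambda>\<omega>. f False \<omega> - f True \<omega>) \<omega> = V \<omega>"
    and P [measurable]: "Measurable.pred F P" and P_iff: "\<And>\<omega>. P \<omega> \<longleftrightarrow> 0 \<le> V \<omega>"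
  shows "(\<integral>\<omega>. f (P \<omega>) \<omega> \<partial>M) \<le> (\<integral>\<omega>. f b \<omega> \<partial>M)"
proof -
  define gap where "gap \<omega> = f False \<omega> - f True \<omega>" for \<omega>
  define s :: "'a \<Rightarrow> real" where "s \<omega> = of_bool (P \<omega>) - of_bool b" for \<omega>
  have f_P: "f (P \<omega>) \<omega> = f b \<omega> - s \<omega> * gap \<omega>" for \<omega>
    by (cases b; cases "P \<omega>") (simp_all add: s_def gap_def)
  have gap: "integrable M gap"
    unfolding gap_def using f by (intro Bochner_Integration.integrable_diff)
  have s: "s \<in> borel_measurable F"
    unfolding s_def by measurable
  have s_gap: "integrable M (\<lambda>\<omega>. s \<omega> * gap \<omega>)"
  proof (rule Bochner_Integration.integrable_bound[OF gap])
    show "(\<lambda>\<omega>. s \<omega> * gap \<omega>) \<in> borel_measurable M"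
      using measurable_from_subalg[OF subalg s] borel_measurable_integrable[OF gap] by measurable
    show "AE \<omega> in M. norm (s \<omega> * gap \<omega>) \<le> norm (gap \<omega>)"
      by (simp add: s_def)
  qed
  have "0 \<le> (\<integral>\<omega>. s \<omega> * real_cond_exp M F gap \<omega> \<partial>M)"
  proof (rule integral_nonneg_AE)
    have "AE \<omega> in M. real_cond_exp M F gap \<omega> = V \<omega>"
      using V by (simp add: gap_def[abs_def])
    then show "AE \<omega> in M. 0 \<le> s \<omega> * real_cond_exp M F gap \<omega>"
      by eventually_elim (cases b; simp add: s_def P_iff)
  qed
  also have "\<dots> = (\<integral>\<omega>. s \<omega> * gap \<omega> \<partial>M)"
    by (rule real_cond_exp_intg(2)[OF s_gap s borel_measurable_integrable[OF gap]])
  finally show ?thesis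
    using f s_gap by (simp add: f_P)
qed

end

lemma (in prob_space) indep_var_indep_set:
  assumes F: "subalgebra M F" and G: "subalgebra M G" and indep: "indep_set (sets F) (sets G)"
    and X: "X \<in> measurable F S" and Y: "Y \<in> measurable G T"
  shows "indep_var S X T Y"
proof -
  have sets_le: "sigma_sets (space M) {Z -` U \<inter> space M | U. U \<in> sets S'} \<subseteq> sets H"
    if "subalgebra M H" "Z \<in> measurable H S'" for H S' and Z :: "'a \<Rightarrow> 'z"
  proof -
    have space_H: "space H = space M" using that(1) by (simp add: subalgebra_def)
    have "{Z -` U \<inter> space H | U. U \<in> sets S'} \<subseteq> sets H"
      using measurable_sets[OF that(2)] by auto
    then show ?thesis
      unfolding space_H[symmetric] by (rule sets.sigma_sets_subset)
  qed
  have "indep_set (sigma_sets (space M) {X -` U \<inter> space M | U. U \<in> sets S})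
      (sigma_sets (space M) {Y -` U \<inter> space M | U. U \<in> sets T})"
    using indep unfolding indep_set_def
    by (rule indep_sets_mono_sets) (simp add: sets_le[OF F X] sets_le[OF G Y] split: bool.split)
  then show ?thesis
    unfolding indep_var_eq
    by (intro conjI measurable_from_subalg[OF F X] measurable_from_subalg[OF G Y])
qed

lemma (in prob_space) cond_exp_version_indep:
  fixes X :: "'a \<Rightarrow> 'b::euclidean_space"
  assumes F: "subalgebra M F" and G: "subalgebra M G" and indep: "indep_set (sets F) (sets G)"
    and X: "X \<in> borel_measurable G" "integrable M X"
  shows "cond_exp_version M F X (\<lambda>_. expectation X)"
  unfolding cond_exp_version_def
proof (intro conjI ballI)
  fix b :: 'b
  interpret F: finite_measure_subalgebra M F by unfold_locales (rule F)
  have X_b: "(\<lambda>\<omega>. X \<omega> \<bullet> b) \<in> borel_measurable G" "integrable M (\<lambda>\<omega>. X \<omega> \<bullet> b)"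
    using X by simp_all
  have "(\<integral>\<omega>\<in>E. X \<omega> \<bullet> b \<partial>M) = (\<integral>\<omega>\<in>E. expectation X \<bullet> b \<partial>M)" if E: "E \<in> sets F" for E
  proof -
    have [measurable]: "E \<in> sets M" using E F by (auto simp: subalgebra_def)
    have "indep_var borel (indicator E :: 'a \<Rightarrow> real) borel (\<lambda>\<omega>. X \<omega> \<bullet> b)"
      by (rule indep_var_indep_set[OF F G indep borel_measurable_indicator[OF E] X_b(1)])
    moreover have "integrable M (indicator E :: 'a \<Rightarrow> real)"
      by (simp add: less_top[symmetric])
    ultimately have "expectation (\<lambda>\<omega>. indicator E \<omega> * (X \<omega> \<bullet> b))
        = prob E * expectation (\<lambda>\<omega>. X \<omega> \<bullet> b)"
      by (subst indep_var_lebesgue_integral[OF _ _ X_b(2)]) auto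
    then show ?thesis
      using X(2) by (simp add: set_lebesgue_integral_def)
  qed
  then show "AE \<omega> in M. real_cond_exp M F (\<lambda>\<omega>. X \<omega> \<bullet> b) \<omega> = expectation X \<bullet> b"
    by (rule F.real_cond_exp_charact[OF _ X_b(2)]) simp_all
qed simp

section \<open>Gaussian random vectors\<close>

context prob_space
begin

lemma gaussian_rv_inner_cases:
  assumes X: "gaussian_rv M X m \<Sigma>" and \<Sigma>: "psd_mat \<Sigma>"
  obtains (degenerate) "AE \<omega> in M. a \<bullet> X \<omega> = a \<bullet> m"
  | (normal) \<sigma> where "0 < \<sigma>" "distributed M lborel (\<lambda>\<omega>. a \<bullet> X \<omega>) (normal_density (a \<bullet> m) \<sigma>)"
proof -
  have X_a: "if a \<bullet> (\<Sigma> *v a) = 0 then (AE \<omega> in M. a \<bullet> X \<omega> = a \<bullet> m)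
    else distributed M lborel (\<lambda>\<omega>. a \<bullet> X \<omega>) (normal_density (a \<bullet> m) (sqrt (a \<bullet> (\<Sigma> *v a))))"
    using X unfolding gaussian_rv_def by blast
  show thesis
  proof (cases "a \<bullet> (\<Sigma> *v a) = 0")
    case True
    then show thesis using X_a degenerate by simp
  next
    case False
    then have "0 < sqrt (a \<bullet> (\<Sigma> *v a))" using \<Sigma> by (simp add: psd_mat_def less_le)
    then show thesis by (rule normal) (use X_a False in simp)
  qed
qed

lemma sq_integrable_normal:
  assumes "0 < \<sigma>" and D: "distributed M lborel X (normal_density \<mu> \<sigma>)"
  shows "sq_integrable M X"
proof -
  have "integrable M (\<lambda>\<omega>. (X \<omega> - \<mu>)\<^sup>2)"
    using distributed_integrable[OF D, of "\<lambda>x. (x - \<mu>)\<^sup>2"]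
      integrable_normal_moment[OF assms(1), of \<mu> 2] by simp
  then have "sq_integrable M (\<lambda>\<omega>. X \<omega> - \<mu>)"
    using distributed_measurable[OF D] by (simp add: sq_integrable_def)
  then show ?thesis
    using sq_integrable_add[OF _ sq_integrable_const[of \<mu>]] by fastforce
qed

lemma gaussian_rv_sq_integrable:
  assumes X: "gaussian_rv M X m \<Sigma>" and \<Sigma>: "psd_mat \<Sigma>"
  shows "sq_integrable M X"
proof (rule sq_integrable_componentwise)
  fix b
  have meas [measurable]: "X \<in> borel_measurable M" using X by (simp add: gaussian_rv_def)
  have "sq_integrable M (\<lambda>\<omega>. b \<bullet> X \<omega>)"
    using X \<Sigma>
  proof (cases rule: gaussian_rv_inner_cases[where a = b])
    case degenerate
    then have "integrable M (\<lambda>\<omega>. (norm (b \<bullet> X \<omega>))\<^sup>2) \<longleftrightarrow> integrable M (\<lambda>\<omega>. (norm (b \<bullet> m))\<^sup>2)"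
      by (intro integrable_cong_AE) auto
    then show ?thesis by (simp add: sq_integrable_def)
  next
    case (normal \<sigma>)
    then show ?thesis by (rule sq_integrable_normal)
  qed
  then show "sq_integrable M (\<lambda>\<omega>. X \<omega> \<bullet> b)" by (simp add: inner_commute)
qed

lemma gaussian_rv_expectation:
  assumes X: "gaussian_rv M X m \<Sigma>" and \<Sigma>: "psd_mat \<Sigma>"
  shows "expectation X = m"
proof (rule euclidean_eqI)
  fix b :: "real^'b"
  have meas [measurable]: "X \<in> borel_measurable M" using X by (simp add: gaussian_rv_def)
  have "expectation (\<lambda>\<omega>. b \<bullet> X \<omega>) = b \<bullet> m"
    using X \<Sigma>
  proof (cases rule: gaussian_rv_inner_cases[where a = b])
    case degenerate
    then have "expectation (\<lambda>\<omega>. b \<bullet> X \<omega>) = expectation (\<lambda>\<omega>. b \<bullet> m)"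
      by (intro integral_cong_AE) auto
    then show ?thesis by (simp add: prob_space)
  next
    case (normal \<sigma>)
    then show ?thesis by (rule normal_distributed_expectation)
  qed
  then show "expectation X \<bullet> b = m \<bullet> b"
    using sq_integrable_imp_integrable[OF gaussian_rv_sq_integrable[OF X \<Sigma>]]
    by (simp add: inner_commute)
qed

end

section \<open>Information generated by a family of random variables\<close>

definition generated_info ::
  "'w measure \<Rightarrow> ('i \<Rightarrow> 'w \<Rightarrow> 'b::topological_space) \<Rightarrow> 'i set \<Rightarrow> 'w measure" where
  "generated_info M X J = sigma (space M) (\<Union>i\<in>J. {X i -` T \<inter> space M | T. T \<in> sets borel})"

lemma space_generated_info [simp]: "space (generated_info M X J) = space M"
  unfolding generated_info_def by (auto intro!: space_measure_of)

lemma sets_generated_info: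
  "sets (generated_info M X J) =
    sigma_sets (space M) (\<Union>i\<in>J. {X i -` T \<inter> space M | T. T \<in> sets borel})"
  unfolding generated_info_def by (auto intro!: sets_measure_of)

lemma measurable_generated_info:
  assumes "i \<in> J"
  shows "X i \<in> borel_measurable (generated_info M X J)"
  using assms by (intro measurableI) (auto simp: sets_generated_info intro!: sigma_sets.Basic)

lemma subalgebra_generated_info:
  assumes "space H = space M" "\<And>i. i \<in> J \<Longrightarrow> X i \<in> borel_measurable H"
  shows "subalgebra H (generated_info M X J)"
proof -
  have "(\<Union>i\<in>J. {X i -` T \<inter> space M | T. T \<in> sets borel}) \<subseteq> sets H"
    using assms(2) unfolding assms(1)[symmetric] by (auto intro: measurable_sets)
  then show ?thesis
    unfolding subalgebra_def space_generated_info sets_generated_info assms(1)[symmetric]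
    by (simp add: sets.sigma_sets_subset)
qed

lemma generated_info_mono:
  "J \<subseteq> K \<Longrightarrow> subalgebra (generated_info M X K) (generated_info M X J)"
  by (intro subalgebra_generated_info measurable_generated_info) auto

lemma (in prob_space) indep_set_generated_info:
  fixes X :: "'i \<Rightarrow> 'a \<Rightarrow> 'b::topological_space"
  assumes indep: "indep_vars (\<lambda>_. borel) X I" and JK: "J \<subseteq> I" "K \<subseteq> I" "J \<inter> K = {}"
  shows "indep_set (sets (generated_info M X J)) (sets (generated_info M X K))"
proof -
  let ?E = "\<lambda>i. {X i -` T \<inter> space M | T. T \<in> sets borel}"
  have "indep_sets (\<lambda>b. sigma_sets (space M) (\<Union>i\<in>case_bool J K b. ?E i)) UNIV"
  proof (rule indep_sets_collect_sigma)
    have "indep_sets ?E I" using indep by (simp add: indep_vars_def2)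
    then show "indep_sets ?E (\<Union>b\<in>UNIV. case_bool J K b)"
      by (rule indep_sets_mono_index[rotated]) (use JK in \<open>auto split: bool.splits\<close>)
    show "disjoint_family_on (case_bool J K) UNIV"
      using JK by (auto simp: disjoint_family_on_def split: bool.splits)
  next
    fix i
    show "Int_stable (?E i)"
      unfolding Int_stable_def
    proof safe
      fix T T' :: "'b set" assume "T \<in> sets borel" "T' \<in> sets borel"
      then show "\<exists>U. X i -` T \<inter> space M \<inter> (X i -` T' \<inter> space M) = X i -` U \<inter> space M
          \<and> U \<in> sets borel"
        by (intro exI[of _ "T \<inter> T'"]) auto
    qed
  qed
  then show ?thesis
    unfolding indep_set_def sets_generated_info
    by (rule indep_sets_mono_sets) (auto split: bool.split)
qed

section \<open>Closed loop under an event trigger\<close>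

lemma causal_recursion_fixed_point:
  fixes pre :: "nat \<Rightarrow> nat \<Rightarrow> 'a"
  assumes rec: "\<And>k. pre (Suc k) = (pre k)(k := F (pre k) k)"
    and causal: "\<And>d d' k. (\<And>t. t < k \<Longrightarrow> d t = d' t) \<Longrightarrow> F d k = F d' k"
  shows "pre (Suc k) k = F (\<lambda>t. pre (Suc t) t) k"
proof -
  have "pre n t = pre (Suc t) t" if "t < n" for n t
    using that by (induction n) (auto simp: rec less_Suc_eq)
  then have "F (pre k) k = F (\<lambda>t. pre (Suc t) t) k" by (rule causal)
  then show ?thesis by (simp add: rec)
qed

locale closed_loop = lq_system A B Q R N
  for A :: "nat \<Rightarrow> real^'n^'n" and B :: "nat \<Rightarrow> real^'m^'n"
    and Q :: "nat \<Rightarrow> real^'n^'n" and R :: "nat \<Rightarrow> real^'m^'m" and N :: nat +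
  fixes M :: "'w measure"
    and C :: "nat \<Rightarrow> real^'n^'p" and W :: "nat \<Rightarrow> real^'n^'n" and V :: "nat \<Rightarrow> real^'p^'p"
    and th :: "nat \<Rightarrow> real" and m0 :: "real^'n" and M0 :: "real^'n^'n"
    and x0 :: "'w \<Rightarrow> real^'n" and w :: "nat \<Rightarrow> 'w \<Rightarrow> real^'n" and v :: "nat \<Rightarrow> 'w \<Rightarrow> real^'p"
begin

abbreviation "loop d k \<omega> \<equiv> icl A B C W V L m0 M0 x0 w v d k \<omega>"
abbreviation "state d k \<omega> \<equiv> fst (loop d k \<omega>)"
abbreviation "estimate d k \<omega> \<equiv> fst (snd (loop d k \<omega>))"
abbreviation "error_cov d k \<omega> \<equiv> snd (snd (loop d k \<omega>))"
abbreviation "est_error d k \<omega> \<equiv> state d k \<omega> - estimate d k \<omega>"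
abbreviation "observation d k \<omega> \<equiv> C k *v state d k \<omega> + v k \<omega>"
abbreviation "correction d k \<omega> \<equiv>
  kgain A C V k (error_cov d k \<omega>) *v (observation d k \<omega> - C k *v estimate d k \<omega>)"
abbreviation "drift d k \<omega> \<equiv> A k *v state d k \<omega> + B k *v (- (L k *v estimate d k \<omega>))"
abbreviation "info d k \<equiv> iinfo M A B C W V L m0 M0 x0 w v d k"

definition cov_step :: "nat \<Rightarrow> bool \<Rightarrow> real^'n^'n \<Rightarrow> real^'n^'n" where
  "cov_step k b P = A k ** P ** transpose (A k) + W k
     - (if b then kgain A C V k P ** C k ** P ** transpose (A k) else 0)"

lemma state_Suc: "state d (Suc k) \<omega> = drift d k \<omega> + w k \<omega>"
  by (simp add: Let_def split_beta)

lemma estimate_Suc: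
  "estimate d (Suc k) \<omega> = A k *v estimate d k \<omega> + B k *v (- (L k *v estimate d k \<omega>))
     + (if d k \<omega> then correction d k \<omega> else 0)"
  by (simp add: Let_def split_beta)

lemma est_error_Suc:
  "est_error d (Suc k) \<omega> = A k *v est_error d k \<omega> + w k \<omega> - (if d k \<omega> then correction d k \<omega> else 0)"
  unfolding state_Suc estimate_Suc by (simp add: matrix_vector_mult_diff_distrib)

lemma error_cov_Suc: "error_cov d (Suc k) \<omega> = cov_step k (d k \<omega>) (error_cov d k \<omega>)"
  by (simp add: cov_step_def Let_def split_beta)

declare icl.simps(2) [simp del]

lemma loop_cong:
  assumes "\<And>t. t < k \<Longrightarrow> d t \<omega> = d' t \<omega>"
  shows "loop d k \<omega> = loop d' k \<omega>"
  using assms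
proof (induction k)
  case (Suc k)
  then have "loop d k \<omega> = loop d' k \<omega>" "d k \<omega> = d' k \<omega>" by auto
  then show ?case by (simp add: icl.simps(2))
qed simp

lemma loop_switch_at: "t \<le> k \<Longrightarrow> loop (switch_at d k b dbar) t \<omega> = loop d t \<omega>"
  by (intro loop_cong) (simp add: switch_at_def)

lemma info_eq_generated_info: "info d k = generated_info M (observation d) {..k}"
  by (simp add: iinfo_def generated_info_def)

lemma space_info [simp]: "space (info d k) = space M"
  by (simp add: info_eq_generated_info)

lemma observation_info: "t \<le> k \<Longrightarrow> observation d t \<in> borel_measurable (info d k)"
  using measurable_generated_info[of t "{..k}" "observation d" M]
  by (simp add: info_eq_generated_info)

lemma info_mono: "t \<le> k \<Longrightarrow> subalgebra (info d k) (info d t)"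
  unfolding info_eq_generated_info by (intro generated_info_mono) simp

lemma info_cong:
  assumes "\<And>t. t < k \<Longrightarrow> d t = d' t"
  shows "info d k = info d' k"
proof -
  have "state d t \<omega> = state d' t \<omega>" if "t \<le> k" for t \<omega>
    using loop_cong[of t d \<omega> d'] assms that by simp
  then show ?thesis
    unfolding iinfo_def by (intro arg_cong[where f = "sigma (space M)"] SUP_cong refl) simp
qed

subsection \<open>Adapted triggers\<close>

definition adapted :: "nat \<Rightarrow> (nat \<Rightarrow> 'w \<Rightarrow> bool) \<Rightarrow> bool" where
  "adapted n d \<longleftrightarrow> (\<forall>k<n. Measurable.pred (info d k) (d k))"

lemma adapted_const: "adapted n (\<lambda>k _. b k)"
  by (simp add: adapted_def)

lemma adapted_mono: "adapted n d \<Longrightarrow> k \<le> n \<Longrightarrow> adapted k d"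
  by (simp add: adapted_def)

lemma adapted_info:
  assumes "adapted n d" "t < n" "t \<le> k"
  shows "Measurable.pred (info d k) (d t)"
  by (rule measurable_from_subalg[OF info_mono[OF assms(3)]])
    (use assms(1,2) in \<open>simp add: adapted_def\<close>)

lemma adapted_switch_at:
  assumes d: "adapted n d"
  shows "adapted n (switch_at d k b dbar)"
  unfolding adapted_def
proof (intro allI impI)
  fix t assume "t < n"
  show "Measurable.pred (info (switch_at d k b dbar) t) (switch_at d k b dbar t)"
  proof (cases "t < k")
    case True
    then have "info (switch_at d k b dbar) t = info d t"
      by (intro info_cong) (simp add: switch_at_def)
    then show ?thesis
      using adapted_info[OF d \<open>t < n\<close>, of t] True by (simp add: switch_at_def)
  qed (simp add: switch_at_def)
qed

text \<open>The error covariance takes finitely many values, so the Kalman gain is a simple function of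
  the past decisions and no measurability of matrix inversion is needed.\<close>

lemma finite_range_error_cov: "finite (range (error_cov d k))"
proof (induction k)
  case (Suc k)
  have "range (error_cov d (Suc k)) \<subseteq> (\<lambda>(b, P). cov_step k b P) ` (UNIV \<times> range (error_cov d k))"
    by (auto simp: error_cov_Suc)
  then show ?case
    by (rule finite_subset) (use Suc in simp)
qed simp

lemma error_cov_info:
  assumes "adapted k d"
  shows "error_cov d k \<in> measurable (info d k) (count_space UNIV)"
  using assms
proof (induction k)
  case (Suc k)
  have "error_cov d k \<in> measurable (info d k) (count_space UNIV)"
    using Suc by (simp add: adapted_mono)
  then have cov: "error_cov d k \<in> measurable (info d (Suc k)) (count_space UNIV)"
    by (intro measurable_from_subalg[OF info_mono[of k "Suc k" d]]) simp_all
  show ?case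
    unfolding error_cov_Suc
  proof (rule measurable_compose_countable[where g = "d k"])
    show "Measurable.pred (info d (Suc k)) (d k)"
      by (rule adapted_info[OF Suc.prems]) simp_all
    show "(\<lambda>\<omega>. cov_step k b (error_cov d k \<omega>)) \<in> measurable (info d (Suc k)) (count_space UNIV)"
      for b
      by (rule measurable_compose[OF cov]) simp
  qed
qed simp

lemma correction_measurable:
  assumes H: "subalgebra H (info d k)" and d: "adapted k d"
    and [measurable]: "estimate d k \<in> borel_measurable H"
  shows "correction d k \<in> borel_measurable H"
proof (rule measurable_compose_countable'[where g = "error_cov d k"])
  show "error_cov d k \<in> measurable H (count_space (range (error_cov d k)))"
    using measurable_from_subalg[OF H error_cov_info[OF d]]
    by (rule measurable_count_space_extend[OF subset_UNIV, rotated]) auto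
  have [measurable]: "observation d k \<in> borel_measurable H"
    by (rule measurable_from_subalg[OF H observation_info]) simp
  show "(\<lambda>\<omega>. kgain A C V k P *v (observation d k \<omega> - C k *v estimate d k \<omega>)) \<in> borel_measurable H"
    for P by measurable
  show "countable (range (error_cov d k))"
    by (rule countable_finite[OF finite_range_error_cov])
qed

lemma estimate_info:
  assumes "adapted k d"
  shows "estimate d k \<in> borel_measurable (info d k)"
  using assms
proof (induction k)
  case (Suc k)
  have sub: "subalgebra (info d (Suc k)) (info d k)"
    by (rule info_mono) simp
  have d: "adapted k d"
    using Suc.prems by (rule adapted_mono) simp
  have [measurable]: "estimate d k \<in> borel_measurable (info d (Suc k))"
    by (rule measurable_from_subalg[OF sub Suc.IH[OF d]])
  have [measurable]: "correction d k \<in> borel_measurable (info d (Suc k))"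
    by (rule correction_measurable[OF sub d]) measurable
  have [measurable]: "Measurable.pred (info d (Suc k)) (d k)"
    by (rule adapted_info[OF Suc.prems]) simp_all
  show ?case unfolding estimate_Suc by measurable
qed simp

lemma correction_info:
  assumes "adapted k d"
  shows "correction d k \<in> borel_measurable (info d k)"
  by (rule correction_measurable[OF info_mono[OF order_refl] assms estimate_info[OF assms]])

lemma loop_measurable:
  assumes d: "adapted k d" and space_H: "space H = space M" and x0: "x0 \<in> borel_measurable H"
    and w: "\<And>t. t < k \<Longrightarrow> w t \<in> borel_measurable H" and v: "\<And>t. t \<le> k \<Longrightarrow> v t \<in> borel_measurable H"
  shows "state d k \<in> borel_measurable H" "subalgebra H (info d k)"
proof -
  have obs: "subalgebra H (info d k)" if "\<And>t. t \<le> k \<Longrightarrow> observation d t \<in> borel_measurable H" for k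
    unfolding info_eq_generated_info by (intro subalgebra_generated_info space_H) (use that in simp)
  have "state d k \<in> borel_measurable H \<and> subalgebra H (info d k)"
    using d w v
  proof (induction k)
    case 0
    then show ?case
      using x0 by (auto intro!: obs borel_measurable_add borel_measurable_matrix_vector_mult)
  next
    case (Suc k)
    have d: "adapted k d"
      using Suc.prems(1) by (rule adapted_mono) simp
    have IH [measurable]: "state d k \<in> borel_measurable H" and sub: "subalgebra H (info d k)"
      using Suc.IH[OF d] Suc.prems by auto
    have [measurable]: "estimate d k \<in> borel_measurable H" "w k \<in> borel_measurable H"
      using measurable_from_subalg[OF sub estimate_info[OF d]] Suc.prems by auto
    have state: "state d (Suc k) \<in> borel_measurable H"
      unfolding state_Suc by measurable
    have "observation d t \<in> borel_measurable H" if "t \<le> Suc k" for t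
    proof (cases "t = Suc k")
      case True
      then show ?thesis using state Suc.prems(3)[of "Suc k"] by simp
    next
      case False
      then show ?thesis using measurable_from_subalg[OF sub observation_info] that by simp
    qed
    then show ?case using state obs by blast
  qed
  then show "state d k \<in> borel_measurable H" "subalgebra H (info d k)" by auto
qed

subsection \<open>Trigger-dependent part of the cost\<close>

abbreviation "cost d \<omega> \<equiv> icost A B C W V Q R th N m0 M0 x0 w v d \<omega>"
abbreviation "tail_cost dbar d k b \<omega> \<equiv> iJ A B C W V Q R th N m0 M0 x0 w v dbar d k b \<omega>"

definition trigger_stage_cost :: "(nat \<Rightarrow> 'w \<Rightarrow> bool) \<Rightarrow> nat \<Rightarrow> 'w \<Rightarrow> real" where
  "trigger_stage_cost d t \<omega> = th t * ind (d t \<omega>)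
     + est_error d (Suc t) \<omega> \<bullet> (\<Gamma> (Suc t) *v est_error d (Suc t) \<omega>)"

definition trigger_cost :: "(nat \<Rightarrow> 'w \<Rightarrow> bool) \<Rightarrow> 'w \<Rightarrow> real" where
  "trigger_cost d \<omega> = (\<Sum>t\<le>N. trigger_stage_cost d t \<omega>)"

definition exogenous_cost :: "'w \<Rightarrow> real" where
  "exogenous_cost \<omega> = x0 \<omega> \<bullet> (S 0 *v x0 \<omega>) + (x0 \<omega> - m0) \<bullet> (\<Gamma> 0 *v (x0 \<omega> - m0))
     + (\<Sum>k\<le>N. w k \<omega> \<bullet> (S (Suc k) *v w k \<omega>))"

lemma trigger_cost_cong:
  assumes "\<And>t. t \<le> N \<Longrightarrow> d t \<omega> = d' t \<omega>"
  shows "trigger_cost d \<omega> = trigger_cost d' \<omega>"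
proof -
  have "loop d (Suc t) \<omega> = loop d' (Suc t) \<omega>" if "t \<le> N" for t
    using assms that by (intro loop_cong) simp
  then show ?thesis
    using assms by (simp add: trigger_cost_def trigger_stage_cost_def)
qed

lemma trigger_cost_switch_at:
  assumes k: "k \<le> N"
  shows "trigger_cost (switch_at d k b dbar) \<omega>
    = (\<Sum>t<k. trigger_stage_cost d t \<omega>) + trigger_stage_cost (switch_at d k b dbar) k \<omega>
      + tail_cost dbar d k b \<omega>"
proof -
  let ?d = "switch_at d k b dbar"
  have "trigger_cost ?d \<omega>
      = (\<Sum>t<k. trigger_stage_cost ?d t \<omega>) + (\<Sum>t\<in>{k..N}. trigger_stage_cost ?d t \<omega>)"
  proof -
    have "{..N} = {..<k} \<union> {k..N}" "{..<k} \<inter> {k..N} = {}" using k by auto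
    then show ?thesis by (simp add: trigger_cost_def sum.union_disjoint)
  qed
  also have "(\<Sum>t\<in>{k..N}. trigger_stage_cost ?d t \<omega>)
      = trigger_stage_cost ?d k \<omega> + (\<Sum>t\<in>{Suc k..N}. trigger_stage_cost ?d t \<omega>)"
    by (rule sum.atLeast_Suc_atMost[OF k])
  also have "(\<Sum>t\<in>{Suc k..N}. trigger_stage_cost ?d t \<omega>) = tail_cost dbar d k b \<omega>"
    unfolding iJ_def Let_def
    by (intro sum.cong) (simp_all add: trigger_stage_cost_def switch_at_def)
  also have "(\<Sum>t<k. trigger_stage_cost ?d t \<omega>) = (\<Sum>t<k. trigger_stage_cost d t \<omega>)"
    by (intro sum.cong)
      (simp_all add: trigger_stage_cost_def loop_switch_at, simp add: switch_at_def)
  finally show ?thesis by (simp add: add.assoc)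
qed

lemma trigger_stage_cost_switch_at:
  "trigger_stage_cost (switch_at d k b dbar) k \<omega> = th k * ind b
     + (A k *v est_error d k \<omega> + w k \<omega> - (if b then correction d k \<omega> else 0))
       \<bullet> (\<Gamma> (Suc k) *v (A k *v est_error d k \<omega> + w k \<omega> - (if b then correction d k \<omega> else 0)))"
  unfolding trigger_stage_cost_def est_error_Suc loop_switch_at[OF order_refl]
  by (simp add: switch_at_def)

subsection \<open>Value of information\<close>

text \<open>The state estimate \<open>z\<close> of the event trigger is a parameter: it is the filtered state under
  imperfect information and the state itself under perfect information.\<close>

definition voi ::
  "(nat \<Rightarrow> bool) \<Rightarrow> ('w \<Rightarrow> real^'n) \<Rightarrow> (nat \<Rightarrow> 'w \<Rightarrow> bool) \<Rightarrow> nat \<Rightarrow> 'w \<Rightarrow> real" where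
  "voi dbar z d k \<omega> =
     correction d k \<omega> \<bullet> (\<Gamma> (Suc k) *v (2 *\<^sub>R (A k *v (z \<omega> - estimate d k \<omega>)) - correction d k \<omega>))
     - th k + irho M A B C W V Q R th N m0 M0 x0 w v dbar d k \<omega>"

lemma voi_cong:
  assumes "\<And>t. t < k \<Longrightarrow> d t = d' t"
  shows "voi dbar z d k = voi dbar z d' k"
proof -
  have "loop d k \<omega> = loop d' k \<omega>" for \<omega>
    using assms by (intro loop_cong) simp
  moreover have "switch_at d k b dbar = switch_at d' k b dbar" for b
    using assms by (auto simp: switch_at_def fun_eq_iff)
  then have "tail_cost dbar d k b = tail_cost dbar d' k b" for b
    by (intro ext) (simp only: iJ_def)
  ultimately show ?thesis
    using info_cong[of k d d'] assms by (intro ext) (simp add: voi_def irho_def Let_def)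
qed

lemma voi_info:
  assumes d: "adapted k d" and [measurable]: "z \<in> borel_measurable (info d k)"
  shows "voi dbar z d k \<in> borel_measurable (info d k)"
proof -
  note [measurable] = estimate_info[OF d] correction_info[OF d]
  show ?thesis unfolding voi_def irho_def Let_def by measurable
qed

lemma adapted_voi_policy:
  assumes policy: "\<And>k \<omega>. k < n \<Longrightarrow> d k \<omega> \<longleftrightarrow> 0 \<le> voi dbar (z k) d k \<omega>"
    and z: "\<And>k. k < n \<Longrightarrow> z k \<in> borel_measurable (info d k)"
  shows "adapted n d"
  using assms
proof (induction n)
  case (Suc n)
  then have d: "adapted n d" and [measurable]: "z n \<in> borel_measurable (info d n)" by auto
  have [measurable]: "voi dbar (z n) d n \<in> borel_measurable (info d n)"
    by (rule voi_info[OF d]) measurable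
  have "d n = (\<lambda>\<omega>. 0 \<le> voi dbar (z n) d n \<omega>)" using Suc.prems(1) by auto
  moreover have "Measurable.pred (info d n) (\<lambda>\<omega>. 0 \<le> voi dbar (z n) d n \<omega>)" by measurable
  ultimately have "Measurable.pred (info d n) (d n)" by simp
  then show ?case using d by (auto simp: adapted_def less_Suc_eq)
qed (simp add: adapted_def)

end

section \<open>Expected cost\<close>

locale square_integrable_lq =
  closed_loop A B Q R N M C W V th m0 M0 x0 w v + riccati A B Q R N + prob_space M
  for A B Q R N and M :: "'w measure" and C W V th m0 M0 x0 w v +
  assumes th_nonneg: "k \<le> N \<Longrightarrow> 0 \<le> th k"
    and x0_sq: "sq_integrable M x0"
    and w_sq: "k \<le> N \<Longrightarrow> sq_integrable M (w k)"
    and v_sq: "k \<le> N \<Longrightarrow> sq_integrable M (v k)"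
begin

lemma subalgebra_info:
  assumes "adapted k d" "k \<le> N"
  shows "subalgebra M (info d k)"
  using assms by (intro loop_measurable sq_integrable_measurable[OF x0_sq]
      sq_integrable_measurable[OF w_sq] sq_integrable_measurable[OF v_sq]) auto

lemma adapted_measurable:
  assumes d: "adapted n d" and t: "t < n" "t \<le> N"
  shows "Measurable.pred M (d t)"
proof (rule measurable_from_subalg)
  show "subalgebra M (info d t)"
    using adapted_mono[OF d, of t] t by (intro subalgebra_info) simp_all
  show "Measurable.pred (info d t) (d t)"
    using adapted_info[OF d t(1)] by simp
qed

lemma sq_integrable_correction:
  assumes k: "k \<le> N" and d: "adapted k d"
    and x: "sq_integrable M (state d k)" "sq_integrable M (estimate d k)"
  shows "sq_integrable M (correction d k)"
proof -
  have innovation: "sq_integrable M (\<lambda>\<omega>. observation d k \<omega> - C k *v estimate d k \<omega>)"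
    by (intro sq_integrable_diff sq_integrable_add sq_integrable_matrix_vector_mult x v_sq k)
  have "finite (range (\<lambda>\<omega>. onorm ((*v) (kgain A C V k (error_cov d k \<omega>)))))"
    using finite_imageI[OF finite_range_error_cov[of d k], of "\<lambda>P. onorm ((*v) (kgain A C V k P))"]
    by (simp add: image_image)
  then obtain c where c: "onorm ((*v) (kgain A C V k (error_cov d k \<omega>))) \<le> c" for \<omega>
    by (meson Max_ge rangeI)
  show ?thesis
  proof (rule sq_integrable_bound[OF innovation, where c = c])
    show "correction d k \<in> borel_measurable M"
      by (rule correction_measurable[OF subalgebra_info[OF d k] d])
        (rule sq_integrable_measurable[OF x(2)])
    show "norm (correction d k \<omega>) \<le> c * norm (observation d k \<omega> - C k *v estimate d k \<omega>)" for \<omega>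
      by (rule order_trans[OF onorm[OF matrix_vector_mul_bounded_linear]])
        (intro mult_right_mono c norm_ge_zero)
  qed
qed

lemma sq_integrable_loop:
  assumes "adapted k d" "k \<le> Suc N"
  shows "sq_integrable M (state d k)" "sq_integrable M (estimate d k)"
proof -
  have "sq_integrable M (state d k) \<and> sq_integrable M (estimate d k)"
    using assms
  proof (induction k)
    case 0
    show ?case using x0_sq sq_integrable_const by simp
  next
    case (Suc k)
    have k: "k \<le> N" and d: "adapted k d"
      using Suc.prems by (auto intro: adapted_mono)
    have x: "sq_integrable M (state d k)" "sq_integrable M (estimate d k)"
      using Suc.IH[OF d] k by auto
    have "Measurable.pred M (d k)"
      using Suc.prems(1) k by (rule adapted_measurable[OF _ lessI])
    then have "sq_integrable M (state d (Suc k))" "sq_integrable M (estimate d (Suc k))"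
      unfolding state_Suc estimate_Suc
      by (intro sq_integrable_add sq_integrable_matrix_vector_mult sq_integrable_uminus
          sq_integrable_if sq_integrable_const sq_integrable_correction x w_sq k d; assumption)+
    then show ?case by simp
  qed
  then show "sq_integrable M (state d k)" "sq_integrable M (estimate d k)" by auto
qed

lemma state_cond_exp_self:
  assumes d: "adapted k d" and k: "k \<le> N" and state: "state d k \<in> borel_measurable (info d k)"
  shows "cond_exp_version M (info d k) (state d k) (state d k)"
proof -
  interpret finite_measure_subalgebra M "info d k"
    by unfold_locales (rule subalgebra_info[OF d k])
  show ?thesis
    using sq_integrable_loop(1)[OF d] k
    by (intro cond_exp_version_self state sq_integrable_imp_integrable) simp
qed

lemma sq_integrable_est_error:
  "adapted k d \<Longrightarrow> k \<le> Suc N \<Longrightarrow> sq_integrable M (est_error d k)"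
  by (intro sq_integrable_diff sq_integrable_loop)

lemma integrable_trigger_cost:
  assumes d: "adapted (Suc N) d"
  shows "integrable M (trigger_cost d)"
proof -
  have "integrable M (trigger_stage_cost d t)" if t: "t \<le> N" for t
    unfolding trigger_stage_cost_def
  proof (intro Bochner_Integration.integrable_add integrable_mult_right)
    have [measurable]: "Measurable.pred M (d t)"
      using d t by (intro adapted_measurable) auto
    have "(\<lambda>\<omega>. ind (d t \<omega>)) \<in> borel_measurable M" unfolding ind_def by measurable
    then show "integrable M (\<lambda>\<omega>. ind (d t \<omega>))"
      by (rule integrable_const_bound[where B = 1, rotated]) (simp add: ind_def)
    show "integrable M (\<lambda>\<omega>. est_error d (Suc t) \<omega> \<bullet> (\<Gamma> (Suc t) *v est_error d (Suc t) \<omega>))"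
      using t by (intro integrable_inner sq_integrable_matrix_vector_mult sq_integrable_est_error
          adapted_mono[OF d]) simp_all
  qed
  then show ?thesis
    unfolding trigger_cost_def by (intro Bochner_Integration.integrable_sum) simp
qed

lemma integrable_tail_cost:
  assumes d: "adapted (Suc N) d"
  shows "integrable M (tail_cost dbar d k b)"
  unfolding iJ_def Let_def
  by (intro Bochner_Integration.integrable_sum Bochner_Integration.integrable_add integrable_const
      integrable_inner sq_integrable_matrix_vector_mult sq_integrable_est_error
      adapted_mono[OF adapted_switch_at[OF d]]) auto

lemma integrable_exogenous_cost: "integrable M exogenous_cost"
  unfolding exogenous_cost_def
  by (intro Bochner_Integration.integrable_add Bochner_Integration.integrable_sum integrable_inner
      sq_integrable_matrix_vector_mult sq_integrable_diff sq_integrable_const x0_sq w_sq) simp_all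

lemma cost_nonneg: "0 \<le> cost d \<omega>"
proof -
  have "0 \<le> x \<bullet> (Q k *v x)" if "k \<le> Suc N" for k x
    using Q_psd[OF that] by (simp add: psd_mat_def)
  moreover have "0 \<le> u \<bullet> (R k *v u)" if "k \<le> N" for k u
    using pd_mat_imp_psd_mat[OF R_pd[OF that]] by (simp add: psd_mat_def)
  moreover have "0 \<le> th k * ind b" if "k \<le> N" for k b
    using th_nonneg[OF that] by (simp add: ind_def)
  ultimately show ?thesis
    unfolding icost_def Let_def
    by (intro add_nonneg_nonneg sum_nonneg) (simp only: atMost_iff le_SucI le_refl)+
qed

lemma lq_cost_telescope:
  assumes "n \<le> Suc N"
  shows "(\<Sum>k<n. state d k \<omega> \<bullet> (Q k *v state d k \<omega>)
        + (- (L k *v estimate d k \<omega>)) \<bullet> (R k *v (- (L k *v estimate d k \<omega>))))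
      + state d n \<omega> \<bullet> (S n *v state d n \<omega>)
    = x0 \<omega> \<bullet> (S 0 *v x0 \<omega>) + (\<Sum>k<n. est_error d k \<omega> \<bullet> (\<Gamma> k *v est_error d k \<omega>)
      + 2 * (w k \<omega> \<bullet> (S (Suc k) *v drift d k \<omega>)) + w k \<omega> \<bullet> (S (Suc k) *v w k \<omega>))"
  using assms
proof (induction n)
  case (Suc n)
  from Suc.prems have "n \<le> N" by simp
  from stage_cost_identity[OF this refl, of "state d n \<omega>" "estimate d n \<omega>" "w n \<omega>"] Suc
  show ?case
    unfolding state_Suc sum.lessThan_Suc by linarith
qed simp

lemma cost_decomposition:
  "cost d \<omega> = exogenous_cost \<omega> + (\<Sum>k\<le>N. 2 * (w k \<omega> \<bullet> (S (Suc k) *v drift d k \<omega>)))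
     + trigger_cost d \<omega>"
proof -
  let ?e = "\<lambda>k. est_error d k \<omega> \<bullet> (\<Gamma> k *v est_error d k \<omega>)"
  have "(\<Sum>k\<le>N. ?e k) = (\<Sum>k\<le>Suc N. ?e k)"
    by (simp add: Gamma_end)
  also have "\<dots> = (x0 \<omega> - m0) \<bullet> (\<Gamma> 0 *v (x0 \<omega> - m0)) + (\<Sum>k\<le>N. ?e (Suc k))"
    by (simp add: sum.atMost_Suc_shift del: sum.atMost_Suc)
  finally show ?thesis
    using lq_cost_telescope[of "Suc N" d \<omega>]
    by (simp only: icost_def exogenous_cost_def trigger_cost_def trigger_stage_cost_def Let_def
        S_end sum.distrib lessThan_Suc_atMost) linarith
qed

end

text \<open>\<open>H k\<close> is the information carried by the primitive randomness up to time \<open>k\<close>. Apart from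
  square integrability, the argument only uses that \<open>w k\<close> is a martingale difference with respect
  to \<open>H\<close>. In particular \<open>V k\<close> may be singular, so that noiseless observation is covered as well.\<close>

locale martingale_noise_lq = square_integrable_lq A B Q R N M C W V th m0 M0 x0 w v
  for A B Q R N and M :: "'w measure" and C W V th m0 M0 x0 w v +
  fixes H :: "nat \<Rightarrow> 'w measure"
  assumes subalgebra_H: "k \<le> N \<Longrightarrow> subalgebra M (H k)"
    and x0_H: "k \<le> N \<Longrightarrow> x0 \<in> borel_measurable (H k)"
    and w_H: "k \<le> N \<Longrightarrow> t < k \<Longrightarrow> w t \<in> borel_measurable (H k)"
    and v_H: "k \<le> N \<Longrightarrow> t \<le> k \<Longrightarrow> v t \<in> borel_measurable (H k)"
    and w_cond_exp: "k \<le> N \<Longrightarrow> cond_exp_version M (H k) (w k) (\<lambda>_. 0)"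
begin

lemma loop_H:
  assumes "adapted k d" "k \<le> N"
  shows "state d k \<in> borel_measurable (H k)" "subalgebra (H k) (info d k)"
proof -
  have "space (H k) = space M"
    using subalgebra_H[OF assms(2)] by (simp add: subalgebra_def)
  then show "state d k \<in> borel_measurable (H k)" "subalgebra (H k) (info d k)"
    using assms by (auto intro!: loop_measurable x0_H w_H v_H)
qed

lemma w_cond_exp_info:
  assumes "adapted k d" "k \<le> N"
  shows "cond_exp_version M (info d k) (w k) (\<lambda>_. 0)"
proof -
  interpret finite_measure_subalgebra M "info d k"
    by unfold_locales (rule subalgebra_info[OF assms])
  show ?thesis
    by (rule cond_exp_version_tower[OF subalgebra_H loop_H(2) sq_integrable_imp_integrable
          w_cond_exp cond_exp_version_self]) (use assms w_sq in simp_all)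
qed

lemma integral_inner_w_eq_0:
  assumes k: "k \<le> N" and h: "h \<in> borel_measurable (H k)" "sq_integrable M h"
  shows "(\<integral>\<omega>. w k \<omega> \<bullet> h \<omega> \<partial>M) = 0"
proof -
  interpret finite_measure_subalgebra M "H k"
    by unfold_locales (rule subalgebra_H[OF k])
  have "(\<integral>\<omega>. h \<omega> \<bullet> w k \<omega> \<partial>M) = (\<integral>\<omega>. real_cond_exp M (H k) (\<lambda>\<omega>. h \<omega> \<bullet> w k \<omega>) \<omega> \<partial>M)"
    by (rule real_cond_exp_int(2)[symmetric, OF integrable_inner[OF h(2) w_sq[OF k]]])
  also have "\<dots> = (\<integral>\<omega>. 0 \<partial>M)"
    using real_cond_exp_inner_sq_integrable[OF h w_sq[OF k] w_cond_exp[OF k]]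
    by (intro integral_cong_AE) simp_all
  finally show ?thesis by (simp add: inner_commute)
qed

lemma expected_drift_noise:
  assumes d: "adapted k d" and k: "k \<le> N"
  shows "integrable M (\<lambda>\<omega>. 2 * (w k \<omega> \<bullet> (S (Suc k) *v drift d k \<omega>)))"
    and "(\<integral>\<omega>. 2 * (w k \<omega> \<bullet> (S (Suc k) *v drift d k \<omega>)) \<partial>M) = 0"
proof -
  have sq: "sq_integrable M (\<lambda>\<omega>. S (Suc k) *v drift d k \<omega>)"
    using sq_integrable_loop[OF d] k
    by (intro sq_integrable_add sq_integrable_matrix_vector_mult sq_integrable_uminus) auto
  then show "integrable M (\<lambda>\<omega>. 2 * (w k \<omega> \<bullet> (S (Suc k) *v drift d k \<omega>)))"
    by (intro integrable_mult_right integrable_inner w_sq k)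
  have [measurable]: "state d k \<in> borel_measurable (H k)" "estimate d k \<in> borel_measurable (H k)"
    using measurable_from_subalg[OF loop_H(2) estimate_info] loop_H(1) d k by auto
  have "(\<lambda>\<omega>. S (Suc k) *v drift d k \<omega>) \<in> borel_measurable (H k)" by measurable
  then show "(\<integral>\<omega>. 2 * (w k \<omega> \<bullet> (S (Suc k) *v drift d k \<omega>)) \<partial>M) = 0"
    using integral_inner_w_eq_0[OF k _ sq] by simp
qed

lemma expected_cost:
  assumes d: "adapted (Suc N) d"
  shows "integrable M (cost d)"
    and "(\<integral>\<omega>. cost d \<omega> \<partial>M) = (\<integral>\<omega>. exogenous_cost \<omega> \<partial>M) + (\<integral>\<omega>. trigger_cost d \<omega> \<partial>M)"
proof -
  let ?cross = "\<lambda>\<omega>. \<Sum>k\<le>N. 2 * (w k \<omega> \<bullet> (S (Suc k) *v drift d k \<omega>))"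
  have d': "adapted k d" if "k \<le> N" for k
    using d that by (auto intro: adapted_mono)
  have cross_int: "integrable M ?cross"
    using expected_drift_noise(1)[OF d'] by (intro Bochner_Integration.integrable_sum) simp
  have cross_0: "(\<integral>\<omega>. ?cross \<omega> \<partial>M) = 0"
    using expected_drift_noise[OF d'] by (subst Bochner_Integration.integral_sum) simp_all
  note int = integrable_exogenous_cost cross_int integrable_trigger_cost[OF d]
  show "integrable M (cost d)"
    unfolding cost_decomposition by (intro Bochner_Integration.integrable_add int)
  show "(\<integral>\<omega>. cost d \<omega> \<partial>M) = (\<integral>\<omega>. exogenous_cost \<omega> \<partial>M) + (\<integral>\<omega>. trigger_cost d \<omega> \<partial>M)"
    unfolding cost_decomposition
    by (simp only: Bochner_Integration.integral_add Bochner_Integration.integrable_add int cross_0)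
qed

abbreviation "expected_total_cost d \<equiv> iPsi M A B C W V Q R th N m0 M0 x0 w v d"

lemma expected_total_cost_mono:
  assumes d: "adapted (Suc N) d" and d': "adapted (Suc N) d'"
    and le: "(\<integral>\<omega>. trigger_cost d \<omega> \<partial>M) \<le> (\<integral>\<omega>. trigger_cost d' \<omega> \<partial>M)"
  shows "expected_total_cost d \<le> expected_total_cost d'"
  unfolding iPsi_def
  using le by (simp add: nn_integral_eq_integral expected_cost[OF d] expected_cost[OF d']
      cost_nonneg ennreal_leI)

section \<open>Policy improvement\<close>

lemma trigger_cost_gap:
  assumes k: "k \<le> N"
  shows "trigger_cost (switch_at d k False dbar) \<omega> - trigger_cost (switch_at d k True dbar) \<omega>
    = correction d k \<omega> \<bullet> (\<Gamma> (Suc k) *v (2 *\<^sub>R (A k *v est_error d k \<omega> + w k \<omega>) - correction d k \<omega>))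
      - th k + (tail_cost dbar d k False \<omega> - tail_cost dbar d k True \<omega>)"
proof -
  have "transpose (\<Gamma> (Suc k)) = \<Gamma> (Suc k)"
    using Gamma_psd[of "Suc k"] k by (simp add: psd_mat_def)
  from symmetric_quadratic_diff[OF this, of "A k *v est_error d k \<omega> + w k \<omega>" "correction d k \<omega>"]
  show ?thesis
    unfolding trigger_cost_switch_at[OF k] trigger_stage_cost_switch_at by (simp add: ind_def)
qed

lemma correction_gap_cond_exp:
  fixes d k
  defines "a \<equiv> \<lambda>\<omega>. \<Gamma> (Suc k) *v (2 *\<^sub>R (A k *v est_error d k \<omega> + w k \<omega>) - correction d k \<omega>)"
  assumes d: "adapted k d" and k: "k \<le> N" and z: "cond_exp_version M (info d k) (state d k) z"
  shows "integrable M (\<lambda>\<omega>. correction d k \<omega> \<bullet> a \<omega>)"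
    and "AE \<omega> in M. real_cond_exp M (info d k) (\<lambda>\<omega>. correction d k \<omega> \<bullet> a \<omega>) \<omega>
      = correction d k \<omega>
        \<bullet> (\<Gamma> (Suc k) *v (2 *\<^sub>R (A k *v (z \<omega> - estimate d k \<omega>)) - correction d k \<omega>))"
proof -
  interpret finite_measure_subalgebra M "info d k"
    by unfold_locales (rule subalgebra_info[OF d k])
  have sq: "sq_integrable M (state d k)" "sq_integrable M (estimate d k)"
    "sq_integrable M (correction d k)"
    using sq_integrable_loop[OF d] sq_integrable_correction[OF k d] k by auto
  have a_sq: "sq_integrable M a"
    unfolding a_def
    by (intro sq_integrable_matrix_vector_mult sq_integrable_diff sq_integrable_scaleR
        sq_integrable_add sq w_sq k)
  then show "integrable M (\<lambda>\<omega>. correction d k \<omega> \<bullet> a \<omega>)"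
    by (rule integrable_inner[OF sq(3)])
  have "cond_exp_version M (info d k) a
      (\<lambda>\<omega>. \<Gamma> (Suc k) *v (2 *\<^sub>R (A k *v (z \<omega> - estimate d k \<omega>) + 0) - correction d k \<omega>))"
    unfolding a_def
    by (intro cond_exp_version_bounded_linear[OF matrix_vector_mul_bounded_linear]
        cond_exp_version_bounded_linear[OF bounded_linear_scaleR_right] cond_exp_version_diff
        cond_exp_version_add cond_exp_version_self z w_cond_exp_info[OF d k] estimate_info[OF d]
        correction_info[OF d] sq_integrable_imp_integrable sq_integrable_matrix_vector_mult
        sq_integrable_diff sq_integrable_scaleR sq_integrable_add sq w_sq k)
  from real_cond_exp_inner_sq_integrable[OF correction_info[OF d] sq(3) a_sq this]
  show "AE \<omega> in M. real_cond_exp M (info d k) (\<lambda>\<omega>. correction d k \<omega> \<bullet> a \<omega>) \<omega>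
      = correction d k \<omega>
        \<bullet> (\<Gamma> (Suc k) *v (2 *\<^sub>R (A k *v (z \<omega> - estimate d k \<omega>)) - correction d k \<omega>))"
    by simp
qed

lemma voi_cond_exp:
  assumes d: "adapted (Suc N) d" and k: "k \<le> N"
    and z: "cond_exp_version M (info d k) (state d k) z"
  shows "AE \<omega> in M. real_cond_exp M (info d k) (\<lambda>\<omega>. trigger_cost (switch_at d k False dbar) \<omega>
      - trigger_cost (switch_at d k True dbar) \<omega>) \<omega> = voi dbar z d k \<omega>"
proof -
  have dk: "adapted k d" using d k by (auto intro: adapted_mono)
  interpret finite_measure_subalgebra M "info d k"
    by unfold_locales (rule subalgebra_info[OF dk k])
  note gap = correction_gap_cond_exp[OF dk k z]
  note int = gap(1) integrable_const[of "th k"]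
    integrable_tail_cost[OF d, of dbar k False] integrable_tail_cost[OF d, of dbar k True]
  have "AE \<omega> in M. real_cond_exp M (info d k) (\<lambda>_. th k) \<omega> = th k"
    by (rule real_cond_exp_F_meas) simp_all
  with gap(2) real_cond_exp_diff[OF int(1,2)] real_cond_exp_diff[OF int(3,4)]
    real_cond_exp_add[OF Bochner_Integration.integrable_diff[OF int(1,2)]
      Bochner_Integration.integrable_diff[OF int(3,4)]]
  show ?thesis
    unfolding trigger_cost_gap[OF k] voi_def irho_def Let_def
    by eventually_elim simp
qed

lemma policy_improvement_step:
  assumes d: "adapted (Suc N) d" and k: "k \<le> N"
    and z: "cond_exp_version M (info d k) (state d k) z"
    and policy: "\<And>\<omega>. d k \<omega> \<longleftrightarrow> 0 \<le> voi dbar z d k \<omega>"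
  shows "(\<integral>\<omega>. trigger_cost (switch_at d (Suc k) (dbar (Suc k)) dbar) \<omega> \<partial>M)
    \<le> (\<integral>\<omega>. trigger_cost (switch_at d k (dbar k) dbar) \<omega> \<partial>M)"
proof -
  have dk: "adapted k d" using d k by (auto intro: adapted_mono)
  interpret finite_measure_subalgebra M "info d k"
    by unfold_locales (rule subalgebra_info[OF dk k])
  have "trigger_cost (switch_at d (Suc k) (dbar (Suc k)) dbar) \<omega>
      = trigger_cost (switch_at d k (d k \<omega>) dbar) \<omega>" for \<omega>
    by (rule trigger_cost_cong) (auto simp: switch_at_def less_Suc_eq)
  moreover have "(\<integral>\<omega>. trigger_cost (switch_at d k (d k \<omega>) dbar) \<omega> \<partial>M)
      \<le> (\<integral>\<omega>. trigger_cost (switch_at d k (dbar k) dbar) \<omega> \<partial>M)"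
  proof (rule integral_threshold_decision_le[OF _ voi_cond_exp[OF d k z] _ policy])
    show "integrable M (trigger_cost (switch_at d k b dbar))" for b
      by (rule integrable_trigger_cost[OF adapted_switch_at[OF d]])
    show "Measurable.pred (info d k) (d k)"
      using d k by (simp add: adapted_def)
  qed
  ultimately show ?thesis by simp
qed

theorem policy_improvement:
  assumes z: "\<And>k. k \<le> N \<Longrightarrow> cond_exp_version M (info d k) (state d k) (z k)"
    and policy: "\<And>k \<omega>. k \<le> N \<Longrightarrow> d k \<omega> \<longleftrightarrow> 0 \<le> voi dbar (z k) d k \<omega>"
  shows "expected_total_cost d \<le> expected_total_cost (\<lambda>k _. dbar k)"
proof (rule expected_total_cost_mono)
  show d: "adapted (Suc N) d"
    using policy cond_exp_version_measurable[OF z] by (intro adapted_voi_policy[of _ _ dbar z]) auto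
  show "adapted (Suc N) (\<lambda>k _. dbar k)" by (rule adapted_const)
  have "(\<integral>\<omega>. trigger_cost (switch_at d n (dbar n) dbar) \<omega> \<partial>M)
      \<le> (\<integral>\<omega>. trigger_cost (switch_at d 0 (dbar 0) dbar) \<omega> \<partial>M)" if "n \<le> Suc N" for n
    using that
  proof (induction n)
    case (Suc n)
    then show ?case using policy_improvement_step[OF d _ z policy, of n] by simp
  qed simp
  note this[OF order_refl]
  moreover have "trigger_cost (switch_at d (Suc N) (dbar (Suc N)) dbar) \<omega> = trigger_cost d \<omega>" for \<omega>
    by (rule trigger_cost_cong) (simp add: switch_at_def)
  moreover have "switch_at d 0 (dbar 0) dbar = (\<lambda>k _. dbar k)"
    by (simp add: switch_at_def fun_eq_iff)
  ultimately show "(\<integral>\<omega>. trigger_cost d \<omega> \<partial>M) \<le> (\<integral>\<omega>. trigger_cost (\<lambda>k _. dbar k) \<omega> \<partial>M)"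
    by simp
qed

end

section \<open>Gaussian systems with independent noise\<close>

locale independent_noise_lq = square_integrable_lq A B Q R N M C W V th m0 M0 x0 w v
  for A B Q R N and M :: "'w measure" and C W V th m0 M0 x0 w v +
  fixes X :: "noise_idx \<Rightarrow> 'w \<Rightarrow> 'x::topological_space" and I :: "noise_idx set"
  assumes indep: "indep_vars (\<lambda>_. borel) X I"
    and Wn_index: "k \<le> N \<Longrightarrow> Wn k \<in> I"
    and w_X: "k \<le> N \<Longrightarrow> w k \<in> borel_measurable (generated_info M X {Wn k})"
    and x0_X: "x0 \<in> borel_measurable (generated_info M X (I - range Wn))"
    and v_X: "k \<le> N \<Longrightarrow> v k \<in> borel_measurable (generated_info M X (I - range Wn))"
    and w_mean: "k \<le> N \<Longrightarrow> expectation (w k) = 0"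

sublocale independent_noise_lq \<subseteq>
  martingale_noise_lq A B Q R N M C W V th m0 M0 x0 w v "\<lambda>k. generated_info M X (I - Wn ` {k..})"
proof
  have sub: "subalgebra M (generated_info M X J)" if "J \<subseteq> I" for J
    using indep that by (intro subalgebra_generated_info) (auto simp: indep_vars_def2)
  have mono: "f \<in> borel_measurable (generated_info M X (I - Wn ` {k..}))"
    if "f \<in> borel_measurable (generated_info M X J)" "J \<subseteq> I - Wn ` {k..}"
    for f :: "'w \<Rightarrow> 'z::topological_space" and J k
    by (rule measurable_from_subalg[OF generated_info_mono[OF that(2)] that(1)])
  fix k t :: nat
  assume k: "k \<le> N"
  show "subalgebra M (generated_info M X (I - Wn ` {k..}))"
    by (rule sub) blast
  show "x0 \<in> borel_measurable (generated_info M X (I - Wn ` {k..}))"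
    by (rule mono[OF x0_X]) auto
  show "w t \<in> borel_measurable (generated_info M X (I - Wn ` {k..}))" if "t < k"
    by (rule mono[OF w_X]) (use that k Wn_index[of t] in auto)
  show "v t \<in> borel_measurable (generated_info M X (I - Wn ` {k..}))" if "t \<le> k"
    by (rule mono[OF v_X]) (use that k in auto)
  have "indep_set (sets (generated_info M X (I - Wn ` {k..}))) (sets (generated_info M X {Wn k}))"
    using Wn_index[OF k] by (intro indep_set_generated_info[OF indep]) auto
  from cond_exp_version_indep[OF sub sub this w_X[OF k] sq_integrable_imp_integrable[OF w_sq[OF k]]]
  show "cond_exp_version M (generated_info M X (I - Wn ` {k..})) (w k) (\<lambda>_. 0)"
    using Wn_index[OF k] by (simp add: w_mean[OF k])
qed

subsection \<open>Imperfect information\<close>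

context closed_loop
begin

definition filtered_state :: "(nat \<Rightarrow> 'w \<Rightarrow> bool) \<Rightarrow> nat \<Rightarrow> 'w \<Rightarrow> real^'n" where
  "filtered_state d k \<omega> = (\<chi> i. real_cond_exp M (info d k) (\<lambda>\<omega>'. state d k \<omega>' $ i) \<omega>)"

lemma filtered_state_cong:
  assumes "\<And>t. t < k \<Longrightarrow> d t = d' t"
  shows "filtered_state d k = filtered_state d' k"
proof -
  have "state d k \<omega> = state d' k \<omega>" for \<omega>
    using assms loop_cong[of k d \<omega> d'] by simp
  then show ?thesis
    using info_cong[of k d d'] assms by (simp add: filtered_state_def fun_eq_iff)
qed

lemma iVoI_eq_voi:
  "iVoI M A B C W V Q R th N m0 M0 x0 w v dbar d k = voi dbar (filtered_state d k) d k"
  by (simp add: iVoI_def voi_def filtered_state_def Let_def fun_eq_iff)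

lemma iplus_iff:
  fixes dbar
  defines "d \<equiv> iplus M A B C W V Q R th N m0 M0 x0 w v dbar"
  shows "d k \<omega> \<longleftrightarrow> 0 \<le> voi dbar (filtered_state d k) d k \<omega>"
proof -
  let ?pre = "iplus_pre M A B C W V Q R th N m0 M0 x0 w v dbar"
  let ?F = "\<lambda>d k \<omega>. 0 \<le> iVoI M A B C W V Q R th N m0 M0 x0 w v dbar d k \<omega>"
  have policy: "d = (\<lambda>t. ?pre (Suc t) t)"
    by (intro ext) (simp only: d_def iplus_def)
  have "d k = ?F d k"
    unfolding policy
  proof (rule causal_recursion_fixed_point[where F = ?F])
    fix d d' :: "nat \<Rightarrow> 'w \<Rightarrow> bool" and k
    assume "\<And>t. t < k \<Longrightarrow> d t = d' t"
    then show "?F d k = ?F d' k"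
      unfolding iVoI_eq_voi using voi_cong[of k d d'] filtered_state_cong[of k d d'] by simp
  qed (rule iplus_pre.simps(2))
  then show ?thesis
    by (simp only: iVoI_eq_voi)
qed

end

theorem imperfect_information_improvement:
  fixes C :: "nat \<Rightarrow> real^'n^'p" and V :: "nat \<Rightarrow> real^'p^'p" and v :: "nat \<Rightarrow> 'w \<Rightarrow> real^'p"
  assumes model: "perfect_model M A B Q R W th N m0 M0 x0 w"
    and imperfect: "imperfect_model M A C V N x0 w v"
  shows "iPsi M A B C W V Q R th N m0 M0 x0 w v (iplus M A B C W V Q R th N m0 M0 x0 w v dbar)
    \<le> iPsi M A B C W V Q R th N m0 M0 x0 w v (\<lambda>k _. dbar k)"
proof -
  interpret prob_space M using model by (simp add: perfect_model_def)
  define X where "X i = (case i of X0 \<Rightarrow> (\<lambda>\<omega>. (x0 \<omega>, 0 :: real^'p))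
    | Wn k \<Rightarrow> (\<lambda>\<omega>. (w k \<omega>, 0 :: real^'p)) | Vn k \<Rightarrow> (\<lambda>\<omega>. (0 :: real^'n, v k \<omega>)))" for i
  let ?I = "insert X0 (Wn ` {..N} \<union> Vn ` {..N})"
  have x0: "gaussian_rv M x0 m0 M0" "psd_mat M0"
    and w: "\<And>k. k \<le> N \<Longrightarrow> gaussian_rv M (w k) 0 (W k)" "\<And>k. k \<le> N \<Longrightarrow> psd_mat (W k)"
    and v: "\<And>k. k \<le> N \<Longrightarrow> gaussian_rv M (v k) 0 (V k)" "\<And>k. k \<le> N \<Longrightarrow> psd_mat (V k)"
    using model imperfect
    by (simp_all add: perfect_model_def imperfect_model_def pd_mat_imp_psd_mat)
  have meas_X: "(\<lambda>\<omega>. fst (X i \<omega>)) \<in> borel_measurable (generated_info M X J)"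
    "(\<lambda>\<omega>. snd (X i \<omega>)) \<in> borel_measurable (generated_info M X J)" if "i \<in> J" for i J
    using measurable_generated_info[OF that, of X M]
    by (simp_all add: borel_prod[symmetric] measurable_fst'' measurable_snd'')
  interpret independent_noise_lq A B Q R N M C W V th m0 M0 x0 w v X ?I
  proof
    show "indep_vars (\<lambda>_. borel) X ?I"
      using imperfect unfolding imperfect_model_def X_def by blast
    fix k
    show "k \<le> Suc N \<Longrightarrow> psd_mat (Q k)" "k \<le> N \<Longrightarrow> pd_mat (R k)" "k \<le> N \<Longrightarrow> 0 \<le> th k"
      using model by (auto simp: perfect_model_def)
    show "w k \<in> borel_measurable (generated_info M X {Wn k})"
      using meas_X(1)[of "Wn k" "{Wn k}"] by (simp add: X_def)
    show "x0 \<in> borel_measurable (generated_info M X (?I - range Wn))"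
      using meas_X(1)[of X0 "?I - range Wn"] by (auto simp: X_def)
    show "v k \<in> borel_measurable (generated_info M X (?I - range Wn))" if "k \<le> N"
      using meas_X(2)[of "Vn k" "?I - range Wn"] that by (auto simp: X_def)
  qed (auto intro: gaussian_rv_sq_integrable gaussian_rv_expectation x0 w v)
  show ?thesis
    by (rule policy_improvement[OF _ iplus_iff])
      (unfold filtered_state_def[abs_def], rule cond_exp_version_vec_lambda)
qed

subsection \<open>Perfect information\<close>

locale perfect_loop = lq_system A B Q R N
  for A :: "nat \<Rightarrow> real^'n^'n" and B :: "nat \<Rightarrow> real^'m^'n"
    and Q :: "nat \<Rightarrow> real^'n^'n" and R :: "nat \<Rightarrow> real^'m^'m" and N :: nat +
  fixes M :: "'w measure" and th :: "nat \<Rightarrow> real" and m0 :: "real^'n"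
    and x0 :: "'w \<Rightarrow> real^'n" and w :: "nat \<Rightarrow> 'w \<Rightarrow> real^'n"

text \<open>Perfect information is noiseless observation of the whole state. The covariances \<open>W\<close> and \<open>M0\<close>
  do not enter the perfect-information loop; they are replaced by \<open>mat 1\<close>, which keeps the error
  covariance invertible, so that the Kalman gain is \<open>A k\<close>.\<close>

sublocale perfect_loop \<subseteq>
  closed_loop A B Q R N M "\<lambda>_. mat 1" "\<lambda>_. mat 1" "\<lambda>_. 0" th m0 "mat 1" x0 w "\<lambda>_ _. 0" .

context perfect_loop
begin

lemma kgain_eq:
  assumes "pd_mat P"
  shows "kgain A (\<lambda>_. mat 1) (\<lambda>_. 0) k P = A k"
proof -
  have "kgain A (\<lambda>_. mat 1) (\<lambda>_. 0) k P = A k ** (P ** matrix_inv P)"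
    by (simp add: kgain_def matrix_mul_assoc)
  then show ?thesis by (simp add: matrix_inv_right[OF pd_mat_invertible[OF assms]])
qed

lemma error_cov_pd: "pd_mat (error_cov d k \<omega>)"
proof (induction k)
  case 0
  show ?case by (simp add: pd_mat_identity)
next
  case (Suc k)
  have "pd_mat (A k ** error_cov d k \<omega> ** transpose (A k) + mat 1)"
    using psd_mat_congruence[OF pd_mat_imp_psd_mat[OF Suc], of "transpose (A k)"]
    by (intro pd_mat_psd_add pd_mat_identity) simp
  then show ?case
    by (simp add: error_cov_Suc cov_step_def kgain_eq[OF Suc] pd_mat_identity)
qed

lemma correction_eq: "correction d k \<omega> = A k *v est_error d k \<omega>"
  by (simp add: kgain_eq[OF error_cov_pd])

lemma pcl_eq_loop: "pcl A B L m0 x0 w d k \<omega> = (state d k \<omega>, estimate d k \<omega>)"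
proof (induction k)
  case (Suc k)
  then show ?case
    unfolding state_Suc estimate_Suc correction_eq by (simp add: Let_def)
qed simp

lemma pPsi_eq_iPsi:
  "pPsi M A B Q R th N m0 x0 w d
    = iPsi M A B (\<lambda>_. mat 1) (\<lambda>_. mat 1) (\<lambda>_. 0) Q R th N m0 (mat 1) x0 w (\<lambda>_ _. 0) d"
  by (simp add: pPsi_def iPsi_def pcost_def icost_def Let_def pcl_eq_loop del: pcl.simps)

lemma pVoI_eq_voi: "pVoI M A B Q R th N m0 x0 w dbar d k = voi dbar (state d k) d k"
proof -
  have "pinfo M A B L m0 x0 w d k = info d k"
    by (simp add: pinfo_def iinfo_def pcl_eq_loop)
  moreover have "pJ A B Q R th N m0 x0 w dbar d k b = tail_cost dbar d k b" for b
    by (intro ext) (simp add: pJ_def iJ_def Let_def pcl_eq_loop del: pcl.simps)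
  ultimately show ?thesis
    unfolding pVoI_def prho_def voi_def irho_def correction_eq Let_def pcl_eq_loop scaleR_2
    by (intro ext) simp
qed

lemma pplus_iff:
  fixes dbar
  defines "d \<equiv> pplus M A B Q R th N m0 x0 w dbar"
  shows "d k \<omega> \<longleftrightarrow> 0 \<le> voi dbar (state d k) d k \<omega>"
proof -
  let ?pre = "pplus_pre M A B Q R th N m0 x0 w dbar"
  let ?F = "\<lambda>d k \<omega>. 0 \<le> pVoI M A B Q R th N m0 x0 w dbar d k \<omega>"
  have policy: "d = (\<lambda>t. ?pre (Suc t) t)"
    by (intro ext) (simp only: d_def pplus_def)
  have "d k = ?F d k"
    unfolding policy
  proof (rule causal_recursion_fixed_point[where F = ?F])
    fix d d' :: "nat \<Rightarrow> 'w \<Rightarrow> bool" and k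
    assume eq: "\<And>t. t < k \<Longrightarrow> d t = d' t"
    then have "state d k = state d' k"
      using loop_cong[of k d _ d'] by (simp add: fun_eq_iff)
    then show "?F d k = ?F d' k"
      unfolding pVoI_eq_voi using voi_cong[of k d d'] eq by simp
  qed (rule pplus_pre.simps(2))
  then show ?thesis
    by (simp only: pVoI_eq_voi)
qed

end

theorem perfect_information_improvement:
  assumes model: "perfect_model M A B Q R W th N m0 M0 x0 w"
  shows "pPsi M A B Q R th N m0 x0 w (pplus M A B Q R th N m0 x0 w dbar)
    \<le> pPsi M A B Q R th N m0 x0 w (\<lambda>k _. dbar k)"
proof -
  interpret prob_space M using model by (simp add: perfect_model_def)
  interpret perfect_loop A B Q R N M th m0 x0 w .
  define X where "X i = (case i of X0 \<Rightarrow> x0 | Wn k \<Rightarrow> w k | Vn k \<Rightarrow> x0)" for i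
  let ?I = "insert X0 (Wn ` {..N})" and ?d = "pplus M A B Q R th N m0 x0 w dbar"
  have x0: "gaussian_rv M x0 m0 M0" "psd_mat M0"
    and w: "\<And>k. k \<le> N \<Longrightarrow> gaussian_rv M (w k) 0 (W k)" "\<And>k. k \<le> N \<Longrightarrow> psd_mat (W k)"
    using model by (simp_all add: perfect_model_def pd_mat_imp_psd_mat)
  interpret independent_noise_lq A B Q R N M "\<lambda>_. mat 1" "\<lambda>_. mat 1" "\<lambda>_. 0" th m0 "mat 1" x0 w
    "\<lambda>_ _. 0" X ?I
  proof
    show "indep_vars (\<lambda>_. borel) X ?I"
      using model unfolding perfect_model_def X_def by blast
    fix k
    show "k \<le> Suc N \<Longrightarrow> psd_mat (Q k)" "k \<le> N \<Longrightarrow> pd_mat (R k)" "k \<le> N \<Longrightarrow> 0 \<le> th k"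
      using model by (auto simp: perfect_model_def)
    show "w k \<in> borel_measurable (generated_info M X {Wn k})"
      using measurable_generated_info[of "Wn k" "{Wn k}" X M] by (simp add: X_def)
    show "x0 \<in> borel_measurable (generated_info M X (?I - range Wn))"
      using measurable_generated_info[of X0 "?I - range Wn" X M] by (auto simp: X_def)
  qed (auto intro: gaussian_rv_sq_integrable gaussian_rv_expectation sq_integrable_const x0 w)
  have state_info: "state ?d k \<in> borel_measurable (info ?d k)" for k
    using observation_info[of k k ?d] by simp
  have "adapted (Suc N) ?d"
    by (rule adapted_voi_policy[OF pplus_iff state_info])
  then have "adapted k ?d" if "k \<le> N" for k
    using that by (simp add: adapted_mono)
  then show ?thesis
    unfolding pPsi_eq_iPsi
    by (intro policy_improvement[OF _ pplus_iff] state_cond_exp_self state_info)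
qed

theorem theorem4:
  fixes M :: "'w measure"
    and A :: "nat \<Rightarrow> real^'n^'n" and B :: "nat \<Rightarrow> real^'m^'n"
    and Q :: "nat \<Rightarrow> real^'n^'n" and R :: "nat \<Rightarrow> real^'m^'m" and W :: "nat \<Rightarrow> real^'n^'n"
    and th :: "nat \<Rightarrow> real" and N :: nat and m0 :: "real^'n" and M0 :: "real^'n^'n"
    and x0 :: "'w \<Rightarrow> real^'n" and w :: "nat \<Rightarrow> 'w \<Rightarrow> real^'n"
    and kp :: nat and dbar :: "nat \<Rightarrow> bool"
  assumes model: "perfect_model M A B Q R W th N m0 M0 x0 w"
    and periodic: "periodic_policy kp dbar"
  shows "pPsi M A B Q R th N m0 x0 w (pplus M A B Q R th N m0 x0 w dbar)
           \<le> pPsi M A B Q R th N m0 x0 w (\<lambda>k _. dbar k)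
         \<and> (\<forall>(C :: nat \<Rightarrow> real^'n^'p) (V :: nat \<Rightarrow> real^'p^'p) (v :: nat \<Rightarrow> 'w \<Rightarrow> real^'p).
              imperfect_model M A C V N x0 w v \<longrightarrow>
              iPsi M A B C W V Q R th N m0 M0 x0 w v
                   (iplus M A B C W V Q R th N m0 M0 x0 w v dbar)
              \<le> iPsi M A B C W V Q R th N m0 M0 x0 w v (\<lambda>k _. dbar k))"
  using perfect_information_improvement[OF model] imperfect_information_improvement[OF model]
  by blast

end
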